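(* Suppose the pseudogradient $\mathbb F$ is restricted $\beta$-cocoercive for some $\beta>0$: $\langle\mathbb F(x)-\mathbb F(x^* ),x-x^*\rangle\ge\beta\|\mathbb F(x)-\mathbb F(x^* )\|^2$ for all $x\in\mathbb R^n$ and all $x^*\in\mathrm{SOL}(\Omega,\mathbb F,G)$. Let $(\gamma_k)_{k\in\mathbb N}$ be a sequence of positive step sizes with $\gamma_k\le2\beta$ for all $k$ and $$\sum_{k=0}^\infty\gamma_k=\infty,\qquad\sum_{k=0}^\infty\gamma_k^2<\infty,\qquad\sum_{k=0}^\infty\gamma_k^2\,\mathbb E\big[\|\epsilon_k\|^2\mid\mathcal F_k\big]<\infty\ \text{ a.s.}$$ Let $(x^k)_{k\in\mathbb N}$ be generated from $x_i^0\in\Omega_i$ by $$x_i^{k+1}=\mathrm{prox}_{\gamma_kg_i}\big[x_i^k-\gamma_k\nabla_{x_i}f_i(x^k,\xi_i^k)\big],\qquad i\in\mathcal I,\ k\ge0.$$ Then $(x^k)_{k\in\mathbb N}$ converges almost surely to a v-SNE of the game.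
   Context: Game. $\mathcal I=\{1,\dots,N\}$ is a set of agents; agent $i$ chooses $x_i\in\Omega_i\subseteq\mathbb R^{n_i}$; $n=\sum_in_i$, $x=\mathrm{col}(x_1,\dots,x_N)$, $x_{-i}=\mathrm{col}((x_j)_{j\ne i})$, $\Omega=\prod_i\Omega_i$. $\xi$ is an $\mathbb R^d$-valued random variable on a probability space $(\Xi,\mathcal F,\mathbb P)$. There are no coupling constraints: given $x_{-i}$, agent $i$ minimizes $\mathbb J_i(x_i,x_{-i})=\mathbb E[f_i(x_i,x_{-i},\xi)]+g_i(x_i)$ over $x_i\in\Omega_i$, where $f_i:\mathbb R^n\times\mathbb R^d\to\mathbb R$ is measurable and the expectation is well defined. Standing assumptions. (a) $g_i:\mathbb R^{n_i}\to\mathbb R\cup\{+\infty\}$ is lower semicontinuous and convex, and $\mathrm{dom}(g_i)=\Omega_i$ is nonempty, compact and convex. (b) For each $x_{-i}$, $x_i\mapsto\mathbb E[f_i(x_i,x_{-i},\xi)]$ is convex and continuously differentiable. (c) For each value of $\xi$ and each $x_{-i}$, $f_i(\cdot,x_{-i},\xi)$ is convex, Lipschitz continuous and continuously differentiable; $f_i(x_i,x_{-i},\cdot)$ is measurable, and for each $x_{-i}$ the Lipschitz constant $\ell_i(x_{-i},\xi)$ is integrable in $\xi$. (d) The pseudogradient $\mathbb F(x)=\mathrm{col}\big((\mathbb E[\nabla_{x_i}f_i(x_i,x_{-i},\xi)])_{i\in\mathcal I}\big)$ is Lipschitz continuous (the constant is not needed by the algorithm). Solution concept. With $g(x)=\sum_ig_i(x_i)$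 and $G(x)=\mathrm{col}(\partial g_1(x_1),\dots,\partial g_N(x_N))$, $\mathrm{SOL}(\Omega,\mathbb F,G)$ is the set of $x^*\in\Omega$ such that $\langle\mathbb F(x^* ),x-x^*\rangle+g(x)-g(x^* )\ge0$ for all $x\in\Omega$. A v-SNE (variational stochastic Nash equilibrium) is an element of this set. Sampling (stochastic approximation: one realization per iteration). $\xi^k=(\xi_1^k,\dots,\xi_N^k)$, $k\ge0$, are i.i.d., each $\xi_i^k$ having the distribution of $\xi$, and independent of $x^0$. $\mathcal F_k$ is the $\sigma$-algebra generated by $x^0,\xi^0,\dots,\xi^{k-1}$. The error is $\epsilon_k=\mathrm{col}(\nabla_{x_1}f_1(x^k,\xi_1^k),\dots,\nabla_{x_N}f_N(x^k,\xi_N^k))-\mathbb F(x^k)$, and $\mathbb E[\epsilon_k\mid\mathcal F_k]=0$ a.s. for all $k\ge0$. Notation. $\mathrm{prox}_{h}(v)=\mathrm{argmin}_u\{h(u)+\frac12\|u-v\|^2\}$. *)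

theory Defs
  imports "HOL-Probability.Probability"
begin

text \<open>
  The joint space of dimension \<open>n = n\<^sub>1 + \<dots> + n\<^sub>N\<close> is \<open>real ^ 'n\<close>, the finite type \<open>'i\<close> is the set of
  agents, and \<open>own :: 'n \<Rightarrow> 'i\<close> tells which agent each coordinate belongs to. The block sizes may
  differ: \<open>n\<^sub>i\<close> is the number of \<open>j\<close> with \<open>own j = i\<close>. The space of agent \<open>i\<close> is represented by the
  coordinate subspace of vectors vanishing outside the block of \<open>i\<close>, with the inner product and
  norm inherited from \<open>real ^ 'n\<close>.
\<close>

definition block_space :: "('n \<Rightarrow> 'i) \<Rightarrow> 'i \<Rightarrow> (real ^ 'n) set" where
  "block_space own i = {u. \<forall>j. own j \<noteq> i \<longrightarrow> u $ j = 0}"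

definition block :: "('n \<Rightarrow> 'i) \<Rightarrow> 'i \<Rightarrow> real ^ 'n \<Rightarrow> real ^ 'n" where
  "block own i x = (\<chi> j. if own j = i then x $ j else 0)"

definition col :: "('n \<Rightarrow> 'i) \<Rightarrow> ('i \<Rightarrow> real ^ 'n) \<Rightarrow> real ^ 'n" where
  "col own v = (\<chi> j. v (own j) $ j)"

text \<open>The point \<open>(u, x\<^sub>-\<^sub>i)\<close>; only block \<open>i\<close> of \<open>u\<close> and the other blocks of \<open>x\<close> matter.\<close>

definition with_block :: "('n \<Rightarrow> 'i) \<Rightarrow> 'i \<Rightarrow> real ^ 'n \<Rightarrow> real ^ 'n \<Rightarrow> real ^ 'n" where
  "with_block own i u x = (\<chi> j. if own j = i then u $ j else x $ j)"

definition joint_set :: "('n \<Rightarrow> 'i) \<Rightarrow> ('i \<Rightarrow> (real ^ 'n) set) \<Rightarrow> (real ^ 'n) set" where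
  "joint_set own \<Omega> = {x. \<forall>i. block own i x \<in> \<Omega> i}"

definition lsc_on :: "'a::topological_space set \<Rightarrow> ('a \<Rightarrow> ereal) \<Rightarrow> bool" where
  "lsc_on S h \<longleftrightarrow> (\<forall>u\<in>S. h u \<le> Liminf (at u within S) h)"

definition ereal_convex_on :: "'a::real_vector set \<Rightarrow> ('a \<Rightarrow> ereal) \<Rightarrow> bool" where
  "ereal_convex_on S h \<longleftrightarrow> convex S \<and>
     (\<forall>u\<in>S. \<forall>v\<in>S. \<forall>t\<in>{0..1}.
        h ((1 - t) *\<^sub>R u + t *\<^sub>R v) \<le> ereal (1 - t) * h u + ereal t * h v)"

definition grad :: "('a::real_inner \<Rightarrow> real) \<Rightarrow> 'a \<Rightarrow> 'a" where
  "grad h x = (THE d. GDERIV h x :> d)"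

definition cont_diff :: "('a::real_inner \<Rightarrow> real) \<Rightarrow> bool" where
  "cont_diff h \<longleftrightarrow> (\<forall>x. GDERIV h x :> grad h x) \<and> continuous_on UNIV (grad h)"

text \<open>The function \<open>u \<mapsto> h (u, x\<^sub>-\<^sub>i)\<close> is constant in the coordinates outside block \<open>i\<close>, so its gradient
  on \<open>real ^ 'n\<close> lies in \<open>block_space own i\<close> and is the partial gradient with respect to \<open>x\<^sub>i\<close>. For the
  same reason convexity, continuous differentiability and Lipschitz continuity (with the same
  constant) of this function on \<open>real ^ 'n\<close> and on \<open>block_space own i\<close> are equivalent.\<close>

definition partial_grad ::
    "('n::finite \<Rightarrow> 'i) \<Rightarrow> 'i \<Rightarrow> (real ^ 'n \<Rightarrow> real) \<Rightarrow> real ^ 'n \<Rightarrow> real ^ 'n" where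
  "partial_grad own i h x = grad (\<lambda>u. h (with_block own i u x)) x"

definition pseudogradient ::
    "('n::finite \<Rightarrow> 'i) \<Rightarrow> 'p measure \<Rightarrow> ('p \<Rightarrow> 's) \<Rightarrow> ('i \<Rightarrow> real ^ 'n \<Rightarrow> 's \<Rightarrow> real)
      \<Rightarrow> real ^ 'n \<Rightarrow> real ^ 'n" where
  "pseudogradient own P \<xi> f x =
     col own (\<lambda>i. \<integral>\<omega>. partial_grad own i (\<lambda>y. f i y (\<xi> \<omega>)) x \<partial>P)"

definition sampled_pseudogradient ::
    "('n::finite \<Rightarrow> 'i::finite) \<Rightarrow> ('i \<Rightarrow> real ^ 'n \<Rightarrow> 's \<Rightarrow> real)
      \<Rightarrow> real ^ 'n \<Rightarrow> 's ^ 'i \<Rightarrow> real ^ 'n" where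
  "sampled_pseudogradient own f x s = col own (\<lambda>i. partial_grad own i (\<lambda>y. f i y (s $ i)) x)"

definition total :: "('n \<Rightarrow> 'i::finite) \<Rightarrow> ('i \<Rightarrow> real ^ 'n \<Rightarrow> ereal) \<Rightarrow> real ^ 'n \<Rightarrow> ereal" where
  "total own g x = (\<Sum>i\<in>UNIV. g i (block own i x))"

definition SOL ::
    "('n::finite \<Rightarrow> 'i::finite) \<Rightarrow> ('i \<Rightarrow> (real ^ 'n) set) \<Rightarrow> (real ^ 'n \<Rightarrow> real ^ 'n)
      \<Rightarrow> ('i \<Rightarrow> real ^ 'n \<Rightarrow> ereal) \<Rightarrow> (real ^ 'n) set" where
  "SOL own \<Omega> F g = {z \<in> joint_set own \<Omega>.
     \<forall>x\<in>joint_set own \<Omega>. 0 \<le> ereal (F z \<bullet> (x - z)) + total own g x - total own g z}"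

text \<open>\<open>arg_min_on\<close> chooses some minimiser. If \<open>h\<close> is convex, lower semicontinuous, never \<open>-\<infinity>\<close> and
  somewhere finite on a coordinate subspace \<open>S\<close>, the minimiser exists and is unique, so that the
  choice is immaterial.\<close>

definition prox :: "'a::real_normed_vector set \<Rightarrow> ('a \<Rightarrow> ereal) \<Rightarrow> 'a \<Rightarrow> 'a" where
  "prox S h v = arg_min_on (\<lambda>u. h u + ereal ((norm (u - v))\<^sup>2 / 2)) S"

definition history ::
    "'w measure \<Rightarrow> ('w \<Rightarrow> 'x::topological_space) \<Rightarrow> (nat \<Rightarrow> 'w \<Rightarrow> 'y::topological_space)
      \<Rightarrow> nat \<Rightarrow> 'w measure" where
  "history M x0 \<zeta> k = sigma (space M)
     ({x0 -` A \<inter> space M | A. A \<in> sets borel} \<union>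
      (\<Union>j<k. {\<zeta> j -` A \<inter> space M | A. A \<in> sets borel}))"

end

theory Submission
  imports Defs
begin

text \<open>
  Write the iteration as a forward-backward step with error, \<open>x' = prox (x - \<gamma> (F x + \<epsilon>))\<close>, and let
  \<open>D\<^sub>z y = \<langle>F z, y - z\<rangle> + g y - g z\<close> be the gap of a solution \<open>z\<close>; it is nonnegative on \<open>\<Omega>\<close> because \<open>z\<close>
  is a solution. The variational characterisation of the proximal point, cocoercivity at \<open>z\<close> and
  Young's inequality give the pathwise estimate (\<open>forward_backward_step\<close>)
    \<open>|x' - z|\<^sup>2 + |x' - x|\<^sup>2 / 2 + 2 \<gamma> (D\<^sub>z x' + \<beta> |F x - F z|\<^sup>2)
       \<le> |x - z|\<^sup>2 + 4 \<gamma>\<^sup>2 |F x - F z|\<^sup>2 + 4 \<gamma>\<^sup>2 |\<epsilon>|\<^sup>2 - 2 \<gamma> \<langle>\<epsilon>, x - z\<rangle>\<close>.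
  The sampling error enters through the last two terms only. Suppose that along a path \<open>\<Sum> \<gamma>\<^sup>2 |\<epsilon>|\<^sup>2\<close>, \<open>\<Sum> \<gamma> \<epsilon>\<close> and
  \<open>\<Sum> \<gamma> \<langle>\<epsilon>, x\<rangle>\<close> converge. Then the right-hand perturbation is summable for every solution \<open>z\<close>
  simultaneously, so \<open>|x\<^sub>k - z|\<close> converges and \<open>\<Sum> \<gamma>\<^sub>k (D\<^sub>z x\<^sub>k\<^sub>+\<^sub>1 + \<beta> |F x\<^sub>k - F z|\<^sup>2)\<close> is finite. As
  \<open>\<Sum> \<gamma>\<^sub>k = \<infinity>\<close>, the summands without their weight vanish along a subsequence, which by compactness
  may be taken to converge to some \<open>l\<close>. There \<open>F l = F z\<close> and, by lower semicontinuity, \<open>D\<^sub>z l \<le> 0\<close>;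
  together these say that \<open>l\<close> is itself a solution. Since \<open>|x\<^sub>k - l|\<close> converges and has a subsequence
  tending to \<open>0\<close>, the whole path converges to \<open>l\<close> (\<open>forward_backward_converges\<close>). Some solution \<open>z\<close> to
  start from exists by Brouwer's theorem, applied to \<open>x \<mapsto> prox (x - F x)\<close>.

  The three series converge almost surely because their conditional second moments are summable.
  Truncating with the predictable event that the conditional sum up to time \<open>k\<close> is at most \<open>m\<close> turns
  this almost sure bound into a bound in expectation (\<open>budget_sum_le\<close>). For \<open>\<Sum> \<gamma>\<^sup>2 |\<epsilon>|\<^sup>2\<close> monotone
  convergence then suffices. The two other series are, coordinate by coordinate, series of martingale
  differences, and an \<open>L\<^sup>2\<close>-bounded martingale converges by a Kolmogorov maximal inequality.
  Letting \<open>m\<close> run through the naturals exhausts the space up to a null set.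

  What remains is to pass between the block structure of the game, with extended-valued \<open>g\<^sub>i\<close>, and a
  single real convex function on the compact set \<open>\<Omega>\<close>, and to check that \<open>x\<^sub>k\<close> is measurable with
  respect to the past: proximal maps are nonexpansive, hence continuous, and partial gradients are
  pointwise limits of difference quotients.
\<close>

section \<open>Lower semicontinuous functions\<close>

definition real_lsc_on :: "'a::topological_space set \<Rightarrow> ('a \<Rightarrow> real) \<Rightarrow> bool" where
  "real_lsc_on K \<phi> \<longleftrightarrow> (\<forall>y\<in>K. \<forall>c<\<phi> y. \<forall>\<^sub>F u in at y within K. c < \<phi> u)"

lemma real_lsc_onD:
  assumes "real_lsc_on K \<phi>" "y \<in> K" "c < \<phi> y"
  obtains U where "open U" "y \<in> U" "\<And>u. u \<in> U \<Longrightarrow> u \<in> K \<Longrightarrow> c < \<phi> u"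
proof -
  have "\<forall>\<^sub>F u in at y within K. c < \<phi> u" using assms by (auto simp: real_lsc_on_def)
  then obtain U where "open U" "y \<in> U" "\<And>u. u \<in> U \<Longrightarrow> u \<noteq> y \<Longrightarrow> u \<in> K \<Longrightarrow> c < \<phi> u"
    unfolding eventually_at_topological by blast
  then show thesis using that assms(3) by metis
qed

lemma real_lsc_on_add:
  assumes "real_lsc_on K \<phi>" "real_lsc_on K \<psi>"
  shows "real_lsc_on K (\<lambda>u. \<phi> u + \<psi> u)"
  unfolding real_lsc_on_def
proof (intro ballI allI impI)
  fix y c assume "y \<in> K" and c: "c < \<phi> y + \<psi> y"
  define d where "d = (\<phi> y + \<psi> y - c) / 2"
  have "\<forall>\<^sub>F u in at y within K. \<phi> y - d < \<phi> u" "\<forall>\<^sub>F u in at y within K. \<psi> y - d < \<psi> u"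
    using assms \<open>y \<in> K\<close> c by (auto simp: real_lsc_on_def d_def)
  then show "\<forall>\<^sub>F u in at y within K. c < \<phi> u + \<psi> u"
    by eventually_elim (simp add: d_def field_simps)
qed

lemma real_lsc_on_sum:
  assumes "\<And>i. i \<in> I \<Longrightarrow> real_lsc_on K (\<phi> i)"
  shows "real_lsc_on K (\<lambda>u. \<Sum>i\<in>I. \<phi> i u)"
proof (cases "finite I")
  case True
  then show ?thesis using assms
    by (induction I) (auto intro: real_lsc_on_add simp: real_lsc_on_def[of K "\<lambda>_. 0"])
qed (simp add: real_lsc_on_def)

lemma continuous_on_imp_real_lsc_on:
  assumes "continuous_on K \<psi>"
  shows "real_lsc_on K \<psi>"
  using assms unfolding real_lsc_on_def continuous_on_def by (blast dest: order_tendstoD(1))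

lemma real_lsc_on_cmult:
  assumes "real_lsc_on K \<phi>" "0 < c"
  shows "real_lsc_on K (\<lambda>u. c * \<phi> u)"
  unfolding real_lsc_on_def
proof (intro ballI allI impI)
  fix y a assume "y \<in> K" "a < c * \<phi> y"
  then have "a / c < \<phi> y" using assms(2) by (simp add: field_simps)
  with assms(1) \<open>y \<in> K\<close> have "\<forall>\<^sub>F u in at y within K. a / c < \<phi> u" by (auto simp: real_lsc_on_def)
  then show "\<forall>\<^sub>F u in at y within K. a < c * \<phi> u"
    by eventually_elim (use assms(2) in \<open>simp add: field_simps\<close>)
qed

lemma real_lsc_on_compose:
  assumes "real_lsc_on L \<phi>" "continuous_on K b" "b ` K \<subseteq> L"
  shows "real_lsc_on K (\<lambda>u. \<phi> (b u))"
  unfolding real_lsc_on_def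
proof (intro ballI allI impI)
  fix y c assume y: "y \<in> K" and "c < \<phi> (b y)"
  then obtain U where U: "open U" "b y \<in> U" "\<And>u. u \<in> U \<Longrightarrow> u \<in> L \<Longrightarrow> c < \<phi> u"
    using assms real_lsc_onD[OF assms(1), of "b y" c] by blast
  have "(b \<longlongrightarrow> b y) (at y within K)" using assms(2) y by (simp add: continuous_on_def)
  then have "\<forall>\<^sub>F u in at y within K. b u \<in> U" using U topological_tendstoD by blast
  moreover have "\<forall>\<^sub>F u in at y within K. u \<in> K" by (simp add: eventually_at_filter)
  ultimately show "\<forall>\<^sub>F u in at y within K. c < \<phi> (b u)"
    by eventually_elim (use U assms(3) in auto)
qed

text \<open>
  If no point were minimal, every point \<open>y\<close> would have a strictly better \<open>b y\<close>, and by lower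
  semicontinuity \<open>b y\<close> would beat a whole neighbourhood of \<open>y\<close>. Finitely many neighbourhoods cover;
  the best of their finitely many \<open>b y\<close> lies in one of them and is beaten itself.
\<close>

lemma real_lsc_on_attains_inf:
  assumes "compact K" "K \<noteq> {}" "real_lsc_on K h"
  shows "\<exists>p\<in>K. \<forall>y\<in>K. h p \<le> h y"
proof (rule ccontr)
  assume "\<not> ?thesis"
  then obtain b where b: "\<And>y. y \<in> K \<Longrightarrow> b y \<in> K \<and> h (b y) < h y" by (metis not_le)
  have "\<exists>U. open U \<and> y \<in> U \<and> (\<forall>u\<in>U \<inter> K. h (b y) < h u)" if "y \<in> K" for y
    using real_lsc_onD[OF assms(3) that, of "h (b y)"] b[OF that] by (metis IntE)
  then have "\<exists>U. \<forall>y\<in>K. open (U y) \<and> y \<in> U y \<and> (\<forall>u\<in>U y \<inter> K. h (b y) < h u)"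
    by (intro bchoice ballI)
  then obtain U where "\<forall>y\<in>K. open (U y) \<and> y \<in> U y \<and> (\<forall>u\<in>U y \<inter> K. h (b y) < h u)" ..
  then have U: "open (U y)" "y \<in> U y" "u \<in> U y \<Longrightarrow> u \<in> K \<Longrightarrow> h (b y) < h u"
    if "y \<in> K" for y u using that by simp_all
  have "K \<subseteq> (\<Union>c\<in>K. U c)" using U(2) by blast
  then obtain C where C: "C \<subseteq> K" "finite C" "K \<subseteq> (\<Union>c\<in>C. U c)"
    using compactE_image[OF assms(1), of K U] U(1) by metis
  have "C \<noteq> {}" using C assms(2) by auto
  then obtain c where c: "c \<in> C" "\<And>d. d \<in> C \<Longrightarrow> h (b c) \<le> h (b d)"
    using ex_min_if_finite[of "(\<lambda>c. h (b c)) ` C"] C(2) by (auto simp: not_less)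
  then have bc: "b c \<in> K" using C(1) b by blast
  then obtain d where d: "d \<in> C" "b c \<in> U d" using C(3) by blast
  then have "h (b d) < h (b c)" using U(3) C(1) bc by blast
  then show False using c(2)[OF d(1)] by simp
qed

lemma real_lsc_on_sequential_le:
  assumes "real_lsc_on K \<phi>" "y \<in> K" "\<And>n. s n \<in> K" "s \<longlonglongrightarrow> y" "(\<lambda>n. r n) \<longlonglongrightarrow> l"
    and le: "\<And>n. \<phi> (s n) \<le> r n"
  shows "\<phi> y \<le> l"
proof (rule ccontr)
  assume "\<not> \<phi> y \<le> l"
  then obtain c where c: "l < c" "c < \<phi> y" by (meson dense not_le)
  obtain U where U: "open U" "y \<in> U" "\<And>u. u \<in> U \<Longrightarrow> u \<in> K \<Longrightarrow> c < \<phi> u"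
    using real_lsc_onD[OF assms(1,2) c(2)] by blast
  have "\<forall>\<^sub>F n in sequentially. s n \<in> U" using assms(4) U topological_tendstoD by blast
  moreover have "\<forall>\<^sub>F n in sequentially. r n < c" using assms(5) c(1) by (rule order_tendstoD)
  ultimately have "\<forall>\<^sub>F n in sequentially. False"
    by eventually_elim (use U assms(3) le in \<open>meson not_less_iff_gr_or_eq order.strict_trans1\<close>)
  then show False by simp
qed

section \<open>Proximal points\<close>

text \<open>
  The variational characterisation of \<open>p = prox\<^sub>\<phi> v\<close>, that is of \<open>v - p\<close> being a subgradient at \<open>p\<close> of
  \<open>\<phi>\<close> plus the indicator function of \<open>K\<close>. It involves neither an extended-valued function nor a
  choice of minimiser.
\<close>

definition prox_point :: "'a::real_inner set \<Rightarrow> ('a \<Rightarrow> real) \<Rightarrow> 'a \<Rightarrow> 'a \<Rightarrow> bool" where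
  "prox_point K \<phi> v p \<longleftrightarrow> p \<in> K \<and> (\<forall>y\<in>K. (v - p) \<bullet> (y - p) \<le> \<phi> y - \<phi> p)"

text \<open>
  Comparing \<open>p\<close> with a point of the segment from \<open>p\<close> to \<open>y\<close> at parameter \<open>t\<close> gives the claim up to a
  term of order \<open>t\<close>, which disappears as \<open>t\<close> tends to \<open>0\<close>.
\<close>

lemma minimiser_imp_prox_point:
  assumes K: "convex K" and \<phi>: "convex_on K \<phi>" and p: "p \<in> K"
    and min: "\<And>y. y \<in> K \<Longrightarrow> \<phi> p + (norm (p - v))\<^sup>2 / 2 \<le> \<phi> y + (norm (y - v))\<^sup>2 / 2"
  shows "prox_point K \<phi> v p"
  unfolding prox_point_def
proof (intro conjI ballI p)
  fix y assume y: "y \<in> K"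
  have *: "(v - p) \<bullet> (y - p) \<le> \<phi> y - \<phi> p + t * ((norm (y - p))\<^sup>2 / 2)" if t: "0 < t" "t \<le> 1" for t
  proof -
    let ?q = "(1 - t) *\<^sub>R p + t *\<^sub>R y"
    have q: "?q \<in> K" using K p y t by (simp add: convexD)
    have "\<phi> ?q \<le> (1 - t) * \<phi> p + t * \<phi> y"
      using \<phi> p y t by (intro convex_onD) auto
    moreover have "(norm (?q - v))\<^sup>2 = (norm (p - v))\<^sup>2 - 2 * t * ((v - p) \<bullet> (y - p)) + t\<^sup>2 * (norm (y - p))\<^sup>2"
      unfolding power2_norm_eq_inner
      by (simp add: inner_simps algebra_simps power2_eq_square inner_commute)
    ultimately have "t * ((v - p) \<bullet> (y - p)) \<le> t * (\<phi> y - \<phi> p + t * ((norm (y - p))\<^sup>2 / 2))"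
      using min[OF q] by (simp add: algebra_simps power2_eq_square)
    then show ?thesis using t(1) by simp
  qed
  have "((\<lambda>t. \<phi> y - \<phi> p + t * ((norm (y - p))\<^sup>2 / 2)) \<longlongrightarrow> \<phi> y - \<phi> p + 0 * ((norm (y - p))\<^sup>2 / 2)) (at_right 0)"
    by (intro tendsto_intros)
  moreover have "\<forall>\<^sub>F t in at_right 0. (v - p) \<bullet> (y - p) \<le> \<phi> y - \<phi> p + t * ((norm (y - p))\<^sup>2 / 2)"
    unfolding eventually_at_right_field using * by (intro exI[of _ 1]) auto
  ultimately show "(v - p) \<bullet> (y - p) \<le> \<phi> y - \<phi> p"
    using tendsto_lowerbound[of _ _ "at_right (0::real)"] by fastforce
qed

lemma prox_point_nonexpansive:
  assumes "prox_point K \<phi> v p" "prox_point K \<phi> w q"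
  shows "norm (p - q) \<le> norm (v - w)"
proof -
  have "(v - p) \<bullet> (q - p) \<le> \<phi> q - \<phi> p" "(w - q) \<bullet> (p - q) \<le> \<phi> p - \<phi> q"
    using assms by (auto simp: prox_point_def)
  then have "(norm (p - q))\<^sup>2 \<le> (v - w) \<bullet> (p - q)"
    unfolding power2_norm_eq_inner by (simp add: inner_simps algebra_simps inner_commute)
  also have "\<dots> \<le> norm (v - w) * norm (p - q)" by (rule norm_cauchy_schwarz)
  finally show ?thesis by (metis mult_right_le_imp_le norm_ge_zero order_le_less power2_eq_square)
qed

lemma prox_point_exists:
  assumes "compact K" "convex K" "K \<noteq> {}" "convex_on K \<phi>" "real_lsc_on K \<phi>"
  shows "\<exists>p. prox_point K \<phi> v p"
proof -
  have "continuous_on K (\<lambda>u. (norm (u - v))\<^sup>2 / 2)" by (intro continuous_intros) auto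
  then have "real_lsc_on K (\<lambda>u. \<phi> u + (norm (u - v))\<^sup>2 / 2)"
    by (intro real_lsc_on_add assms continuous_on_imp_real_lsc_on)
  from real_lsc_on_attains_inf[OF assms(1,3) this] show ?thesis
    using minimiser_imp_prox_point[OF assms(2,4)] by blast
qed

section \<open>Variational inequalities\<close>

definition vi_solutions :: "'a::real_inner set \<Rightarrow> ('a \<Rightarrow> real) \<Rightarrow> ('a \<Rightarrow> 'a) \<Rightarrow> 'a set" where
  "vi_solutions K \<phi> F = {z \<in> K. \<forall>y\<in>K. 0 \<le> F z \<bullet> (y - z) + \<phi> y - \<phi> z}"

text \<open>
  A fixed point \<open>z\<close> of \<open>x \<mapsto> prox\<^sub>\<phi> (x - F x)\<close> solves the variational inequality, by the
  characterisation of the proximal point at \<open>v = z - F z\<close>.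
\<close>

lemma vi_solutions_nonempty:
  fixes F :: "'a::euclidean_space \<Rightarrow> 'a"
  assumes K: "compact K" "convex K" "K \<noteq> {}" "convex_on K \<phi>" "real_lsc_on K \<phi>"
    and F: "continuous_on K F"
  shows "vi_solutions K \<phi> F \<noteq> {}"
proof -
  have "\<forall>v. \<exists>p. prox_point K \<phi> v p" using prox_point_exists[OF K] by blast
  then obtain p where "\<forall>v. prox_point K \<phi> v (p v)" unfolding choice_iff by blast
  then have p: "prox_point K \<phi> v (p v)" for v by blast
  then have pK: "p v \<in> K" for v by (simp add: prox_point_def)
  have "1-lipschitz_on UNIV p"
    by (intro lipschitz_onI) (use prox_point_nonexpansive[OF p p] in \<open>auto simp: dist_norm\<close>)
  then have "continuous_on UNIV p" by (rule lipschitz_on_continuous_on)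
  moreover have "continuous_on K (\<lambda>x. x - F x)" by (intro continuous_intros F)
  ultimately have "continuous_on K (\<lambda>x. p (x - F x))" by (rule continuous_on_compose2) auto
  moreover have "(\<lambda>x. p (x - F x)) \<in> K \<rightarrow> K" using pK by simp
  ultimately obtain z where "z \<in> K" "p (z - F z) = z" using brouwer[OF K(1-3), of "\<lambda>x. p (x - F x)"] by blast
  moreover from this have "F z \<bullet> (y - z) + \<phi> y - \<phi> z \<ge> 0" if "y \<in> K" for y
  proof -
    have "(z - F z - p (z - F z)) \<bullet> (y - p (z - F z)) \<le> \<phi> y - \<phi> (p (z - F z))"
      using p[of "z - F z"] that unfolding prox_point_def by blast
    then show ?thesis using \<open>p (z - F z) = z\<close> by simp
  qed
  ultimately show ?thesis by (auto simp: vi_solutions_def)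
qed

section \<open>Pathwise convergence of the perturbed forward-backward iteration\<close>

text \<open>
  Deterministic form of the Robbins--Siegmund lemma. The perturbations \<open>c\<close> may change sign and
  their series may converge conditionally: subtracting its partial sums makes \<open>a\<close> plus the
  accumulated \<open>b\<close> decreasing.
\<close>

lemma perturbed_decreasing_convergence:
  fixes a b c :: "nat \<Rightarrow> real"
  assumes a: "\<And>k. 0 \<le> a k" and b: "\<And>k. 0 \<le> b k" and c: "summable c"
    and step: "\<And>k. a (Suc k) + b k \<le> a k + c k"
  shows "convergent a" "summable b"
proof -
  define C where "C n = (\<Sum>k<n. c k)" for n
  define B where "B n = (\<Sum>k<n. b k)" for n
  have "convergent C" using c unfolding C_def by (simp add: summable_iff_convergent)
  then have "Bseq C" by (rule convergent_imp_Bseq)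
  then obtain r where r: "\<bar>C n\<bar> \<le> r" for n unfolding Bseq_def by auto
  have le: "a n + B n \<le> a 0 + C n" for n
  proof (induction n)
    case (Suc n)
    then show ?case using step[of n] by (simp add: B_def C_def)
  qed (simp add: B_def C_def)
  have "B n \<le> a 0 + r" for n using le[of n] a[of n] r[of n] by linarith
  then have "(\<Sum>k\<le>n. b k) \<le> a 0 + r" for n unfolding B_def by (metis lessThan_Suc_atMost)
  then show "summable b" using b by (rule bounded_imp_summable[rotated])
  then have "convergent B" unfolding B_def by (simp add: summable_iff_convergent)
  define s where "s n = a n + B n - C n" for n
  have "decseq s" unfolding s_def decseq_Suc_iff B_def C_def using step by (auto simp: algebra_simps)
  moreover have "- r \<le> s n" for n
  proof -
    have "0 \<le> B n" unfolding B_def using b by (simp add: sum_nonneg)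
    then show ?thesis using a[of n] r[of n] by (simp add: s_def abs_le_iff)
  qed
  ultimately obtain l where "s \<longlonglongrightarrow> l" using decseq_convergent[of s "- r"] by blast
  then have "convergent s" by (rule convergentI)
  then have "convergent (\<lambda>n. s n - B n + C n)"
    using \<open>convergent B\<close> \<open>convergent C\<close> by (intro convergent_add convergent_diff)
  then show "convergent a" by (simp add: s_def)
qed

lemma summable_weighted_imp_small:
  fixes \<gamma> w :: "nat \<Rightarrow> real"
  assumes \<gamma>: "\<And>k. 0 < \<gamma> k" "\<not> summable \<gamma>" and w: "\<And>k. 0 \<le> w k" "summable (\<lambda>k. \<gamma> k * w k)"
    and "0 < e"
  shows "\<exists>k\<ge>n. w k < e"
proof (rule ccontr)
  assume "\<not> ?thesis"
  then have "\<gamma> k * e \<le> \<gamma> k * w k" if "k \<ge> n" for k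
    using that \<gamma>(1)[of k] by (auto simp: not_less intro!: mult_left_mono)
  then have "summable (\<lambda>k. \<gamma> k * e)"
    using \<gamma>(1) \<open>0 < e\<close> by (intro summable_comparison_test'[OF w(2), of n]) (simp add: order_less_imp_le abs_mult)
  then show False using \<gamma>(2) \<open>0 < e\<close> by (simp add: summable_mult2 summable_cmult_iff mult.commute)
qed

text \<open>
  Testing the proximal inequality with the solution \<open>z\<close> bounds \<open>|x' - z|\<^sup>2\<close>. Writing
  \<open>\<langle>F x, x' - z\<rangle> = \<langle>F x - F z, x - z\<rangle> + \<langle>F x - F z, x' - x\<rangle> + \<langle>F z, x' - z\<rangle>\<close> isolates the cocoercive
  term, an increment of the iteration and the linear part of the gap at \<open>x'\<close>.
\<close>

lemma forward_backward_step:
  fixes F :: "'a::real_inner \<Rightarrow> 'a"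
  assumes z: "z \<in> vi_solutions K \<phi> F" and \<gamma>: "0 < \<gamma>"
    and p: "prox_point K (\<lambda>u. \<gamma> * \<phi> u) (x - \<gamma> *\<^sub>R (F x + e)) x'"
    and coco: "\<beta> * (norm (F x - F z))\<^sup>2 \<le> (F x - F z) \<bullet> (x - z)"
  shows "(norm (x' - z))\<^sup>2 + ((norm (x' - x))\<^sup>2 / 2
      + 2 * (\<gamma> * ((F z \<bullet> (x' - z) + \<phi> x' - \<phi> z) + \<beta> * (norm (F x - F z))\<^sup>2)))
    \<le> (norm (x - z))\<^sup>2
      + (4 * \<gamma>\<^sup>2 * (norm (F x - F z))\<^sup>2 + 4 * \<gamma>\<^sup>2 * (norm e)\<^sup>2 - 2 * (\<gamma> * (e \<bullet> (x - z))))"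
proof -
  have "z \<in> K" using z by (simp add: vi_solutions_def)
  then have 1: "(x - \<gamma> *\<^sub>R (F x + e) - x') \<bullet> (z - x') \<le> \<gamma> * \<phi> z - \<gamma> * \<phi> x'"
    using p by (auto simp: prox_point_def)
  \<comment> \<open>Applied to \<open>F x - F z\<close> and to \<open>e\<close>, this spends half of the available \<open>|x' - x|\<^sup>2\<close>.\<close>
  have young: "2 * \<gamma> * (u \<bullet> (x - x')) \<le> 4 * \<gamma>\<^sup>2 * (norm u)\<^sup>2 + (norm (x' - x))\<^sup>2 / 4" for u
  proof -
    have "0 \<le> (norm ((2 * \<gamma>) *\<^sub>R u - (1/2) *\<^sub>R (x - x')))\<^sup>2" by simp
    then show ?thesis unfolding power2_norm_eq_inner
      by (simp add: inner_simps algebra_simps power2_eq_square inner_commute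
          add_divide_distrib diff_divide_distrib)
  qed
  have 2: "(norm (x' - z))\<^sup>2 + (norm (x' - x))\<^sup>2
      \<le> (norm (x - z))\<^sup>2 + 2 * (\<gamma> * \<phi> z - \<gamma> * \<phi> x' + \<gamma> * ((F x + e) \<bullet> (z - x')))"
    using 1 unfolding power2_norm_eq_inner by (simp add: inner_simps algebra_simps inner_commute)
  have 3: "\<gamma> * (\<beta> * (norm (F x - F z))\<^sup>2) \<le> \<gamma> * ((F x - F z) \<bullet> (x - z))"
    using coco \<gamma> by simp
  have 4: "\<gamma> * ((F x + e) \<bullet> (z - x')) = \<gamma> * ((F x - F z) \<bullet> (x - x')) + \<gamma> * (e \<bullet> (x - x'))
     - \<gamma> * ((F x - F z) \<bullet> (x - z)) - \<gamma> * (e \<bullet> (x - z)) - \<gamma> * (F z \<bullet> (x' - z))"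
    by (simp add: inner_simps algebra_simps)
  show ?thesis using 2 3 4 young[of "F x - F z"] young[of e]
    by (simp add: algebra_simps)
qed

text \<open>
  The pathwise core. The series \<open>\<Sum> \<gamma> e\<close> and \<open>\<Sum> \<gamma> \<langle>e, x\<rangle>\<close> are required separately so that
  \<open>\<Sum> \<gamma> \<langle>e, x - z\<rangle>\<close> converges for all solutions \<open>z\<close> at once; this allows Fejer monotonicity to be
  used again at the limit point \<open>l\<close>, which depends on the path.
\<close>

lemma forward_backward_converges:
  fixes F :: "'a::euclidean_space \<Rightarrow> 'a"
  assumes K: "compact K" "convex K" "K \<noteq> {}" "convex_on K \<phi>" "real_lsc_on K \<phi>"
    and F: "continuous_on K F" and \<beta>: "0 < \<beta>"
    and coco: "\<And>y z. y \<in> K \<Longrightarrow> z \<in> vi_solutions K \<phi> F \<Longrightarrow> \<beta> * (norm (F y - F z))\<^sup>2 \<le> (F y - F z) \<bullet> (y - z)"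
    and \<gamma>: "\<And>k. 0 < \<gamma> k" "\<not> summable \<gamma>" "summable (\<lambda>k. (\<gamma> k)\<^sup>2)"
    and x0: "x 0 \<in> K"
    and x: "\<And>k. prox_point K (\<lambda>u. \<gamma> k * \<phi> u) (x k - \<gamma> k *\<^sub>R (F (x k) + e k)) (x (Suc k))"
    and e_sq: "summable (\<lambda>k. (\<gamma> k)\<^sup>2 * (norm (e k))\<^sup>2)"
    and e_x: "summable (\<lambda>k. \<gamma> k * (e k \<bullet> x k))"
    and e: "summable (\<lambda>k. \<gamma> k *\<^sub>R e k)"
  shows "\<exists>z \<in> vi_solutions K \<phi> F. x \<longlonglongrightarrow> z"
proof -
  have xK: "x k \<in> K" for k using x0 x by (cases k) (auto simp: prox_point_def)
  define D where "D z y = F z \<bullet> (y - z) + \<phi> y - \<phi> z" for z y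
  have D: "0 \<le> D z y" if "z \<in> vi_solutions K \<phi> F" "y \<in> K" for z y
    using that by (auto simp: vi_solutions_def D_def)
  have "bounded (F ` K)" using F K(1) by (simp add: compact_continuous_image compact_imp_bounded)
  then obtain R where R: "\<And>y. y \<in> K \<Longrightarrow> norm (F y) \<le> R" by (auto simp: bounded_iff)
  \<comment> \<open>Valid for every solution; it is used twice, first at \<open>z\<close> and finally at the limit point \<open>l\<close>.\<close>
  have fejer: "convergent (\<lambda>k. (norm (x k - z))\<^sup>2)"
    "summable (\<lambda>k. (norm (x (Suc k) - x k))\<^sup>2 / 2 + 2 * (\<gamma> k * (D z (x (Suc k)) + \<beta> * (norm (F (x k) - F z))\<^sup>2)))"
    if z: "z \<in> vi_solutions K \<phi> F" for z
  proof -
    have zK: "z \<in> K" using z by (simp add: vi_solutions_def)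
    let ?c = "\<lambda>k. 4 * (\<gamma> k)\<^sup>2 * (norm (F (x k) - F z))\<^sup>2 + 4 * (\<gamma> k)\<^sup>2 * (norm (e k))\<^sup>2 - 2 * (\<gamma> k * (e k \<bullet> (x k - z)))"
    have "summable (\<lambda>k. 4 * (\<gamma> k)\<^sup>2 * (norm (F (x k) - F z))\<^sup>2)"
    proof (rule summable_comparison_test'[of "\<lambda>k. (4 * (2 * R)\<^sup>2) * (\<gamma> k)\<^sup>2" 0])
      fix k
      have "norm (F (x k) - F z) \<le> 2 * R"
        using norm_triangle_ineq4[of "F (x k)" "F z"] R[OF xK] R[OF zK] by (smt (verit))
      then have "(norm (F (x k) - F z))\<^sup>2 \<le> (2 * R)\<^sup>2" by (intro power_mono) auto
      then show "norm (4 * (\<gamma> k)\<^sup>2 * (norm (F (x k) - F z))\<^sup>2) \<le> (4 * (2 * R)\<^sup>2) * (\<gamma> k)\<^sup>2"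
        using mult_left_mono[of "(norm (F (x k) - F z))\<^sup>2" "(2 * R)\<^sup>2" "4 * (\<gamma> k)\<^sup>2"]
        by (simp add: mult_ac)
    qed (intro summable_mult \<gamma>)
    moreover have "summable (\<lambda>k. 4 * (\<gamma> k)\<^sup>2 * (norm (e k))\<^sup>2)"
      using summable_mult[OF e_sq, of 4] by (simp add: mult.assoc)
    moreover have "summable (\<lambda>k. 2 * (\<gamma> k * (e k \<bullet> (x k - z))))"
    proof -
      have "summable (\<lambda>k. (\<gamma> k *\<^sub>R e k) \<bullet> z)"
        by (rule bounded_linear.summable[OF bounded_linear_inner_left e])
      from summable_diff[OF e_x this] show ?thesis
        by (intro summable_mult) (simp add: inner_simps algebra_simps)
    qed
    ultimately have c: "summable ?c" by (intro summable_add summable_diff)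
    let ?b = "\<lambda>k. (norm (x (Suc k) - x k))\<^sup>2 / 2 + 2 * (\<gamma> k * (D z (x (Suc k)) + \<beta> * (norm (F (x k) - F z))\<^sup>2))"
    have b: "0 \<le> ?b k" for k
      using D[OF z xK[of "Suc k"]] \<gamma>(1)[of k] \<beta> by (intro add_nonneg_nonneg mult_nonneg_nonneg) auto
    have step: "(norm (x (Suc k) - z))\<^sup>2 + ?b k \<le> (norm (x k - z))\<^sup>2 + ?c k" for k
      unfolding D_def by (rule forward_backward_step[OF z \<gamma>(1) x coco[OF xK z]])
    show "convergent (\<lambda>k. (norm (x k - z))\<^sup>2)" "summable ?b"
      using perturbed_decreasing_convergence[of "\<lambda>k. (norm (x k - z))\<^sup>2" ?b ?c, OF _ b c step] by simp_all
  qed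
  obtain z where z: "z \<in> vi_solutions K \<phi> F" using vi_solutions_nonempty[OF K F] by auto
  have zK: "z \<in> K" using z by (simp add: vi_solutions_def)
  define w where "w k = D z (x (Suc k)) + \<beta> * (norm (F (x k) - F z))\<^sup>2" for k
  have w: "0 \<le> w k" for k unfolding w_def using D[OF z xK] \<beta> by simp
  have \<gamma>w: "0 \<le> \<gamma> k * w k" for k using w[of k] \<gamma>(1)[of k] by simp
  have "summable (\<lambda>k. (norm (x (Suc k) - x k))\<^sup>2 / 2)"
    by (rule summable_comparison_test'[OF fejer(2)[OF z], of 0])
      (use \<gamma>w in \<open>auto simp: w_def\<close>)
  then have "(\<lambda>k. 2 * ((norm (x (Suc k) - x k))\<^sup>2 / 2)) \<longlonglongrightarrow> 2 * 0"
    by (intro tendsto_intros summable_LIMSEQ_zero)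
  then have "(\<lambda>k. sqrt ((norm (x (Suc k) - x k))\<^sup>2)) \<longlonglongrightarrow> sqrt 0"
    by (intro tendsto_intros) simp
  then have steps: "(\<lambda>k. x (Suc k) - x k) \<longlonglongrightarrow> 0" by (simp add: tendsto_norm_zero_iff)
  have "summable (\<lambda>k. 2 * (\<gamma> k * w k))"
    by (rule summable_comparison_test'[OF fejer(2)[OF z], of 0])
      (use \<gamma>w in \<open>auto simp: w_def\<close>)
  then have "summable (\<lambda>k. \<gamma> k * w k)" by (simp add: summable_cmult_iff)
  then have "\<exists>k\<ge>n. w k < inverse (real (Suc n))" for n
    using summable_weighted_imp_small[OF \<gamma>(1,2) w] by simp
  then obtain m where m: "\<And>n. m n \<ge> n" "\<And>n. w (m n) < inverse (real (Suc n))" by metis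
  have wm: "(\<lambda>n. w (m n)) \<longlonglongrightarrow> 0"
    by (rule tendsto_sandwich[OF _ _ tendsto_const LIMSEQ_inverse_real_of_nat])
      (use m(2) w in \<open>auto intro: always_eventually less_imp_le\<close>)
  have m_top: "filterlim m at_top sequentially"
    using m(1) filterlim_at_top_mono[OF filterlim_ident] by (metis (mono_tags) always_eventually)
  obtain l r where lr: "l \<in> K" "strict_mono r" "((\<lambda>n. x (Suc (m n))) \<circ> r) \<longlonglongrightarrow> l"
    using K(1) xK unfolding compact_def by metis
  define q where "q n = m (r n)" for n
  have r_top: "filterlim r at_top sequentially" using lr(2) by (rule filterlim_subseq)
  have q_top: "filterlim q at_top sequentially"
    unfolding q_def by (rule filterlim_compose[OF m_top r_top])
  have xl1: "(\<lambda>n. x (Suc (q n))) \<longlonglongrightarrow> l" using lr(3) by (simp add: o_def q_def)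
  \<comment> \<open>The gap is evaluated at \<open>x (Suc k)\<close> but \<open>F\<close> at \<open>x k\<close>; vanishing increments give both the same limit.\<close>
  have "(\<lambda>n. x (Suc (q n)) - x (q n)) \<longlonglongrightarrow> 0" using filterlim_compose[OF steps q_top] .
  from tendsto_diff[OF xl1 this] have xl: "(\<lambda>n. x (q n)) \<longlonglongrightarrow> l" by simp
  have wq: "(\<lambda>n. w (q n)) \<longlonglongrightarrow> 0" unfolding q_def by (rule filterlim_compose[OF wm r_top])
  have Fl: "(\<lambda>n. F (x (q n))) \<longlonglongrightarrow> F l"
    using continuous_on_tendsto_compose[OF F xl lr(1)] xK by simp
  have "(\<lambda>n. \<beta> * (norm (F (x (q n)) - F z))\<^sup>2) \<longlonglongrightarrow> 0"
    by (rule tendsto_sandwich[OF _ _ tendsto_const wq])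
      (use D[OF z xK] \<beta> in \<open>auto simp: w_def\<close>)
  moreover have "(\<lambda>n. \<beta> * (norm (F (x (q n)) - F z))\<^sup>2) \<longlonglongrightarrow> \<beta> * (norm (F l - F z))\<^sup>2"
    by (intro tendsto_intros Fl)
  ultimately have "\<beta> * (norm (F l - F z))\<^sup>2 = 0" using LIMSEQ_unique by blast
  then have FlFz: "F l = F z" using \<beta> by simp
  \<comment> \<open>The gap vanishes along \<open>x (Suc (q n))\<close>, and lower semicontinuity passes this on to \<open>l\<close>.\<close>
  have "\<phi> l \<le> 0 - F z \<bullet> (l - z) + \<phi> z"
  proof (rule real_lsc_on_sequential_le[OF K(5) lr(1) xK xl1])
    show "(\<lambda>n. w (q n) - F z \<bullet> (x (Suc (q n)) - z) + \<phi> z) \<longlonglongrightarrow> 0 - F z \<bullet> (l - z) + \<phi> z"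
      by (intro tendsto_intros wq xl1)
    show "\<phi> (x (Suc (q n))) \<le> w (q n) - F z \<bullet> (x (Suc (q n)) - z) + \<phi> z" for n
      using \<beta> by (simp add: w_def D_def)
  qed
  then have "0 \<le> F l \<bullet> (y - l) + \<phi> y - \<phi> l" if "y \<in> K" for y
    using D[OF z that] unfolding FlFz D_def by (simp add: inner_simps)
  then have l: "l \<in> vi_solutions K \<phi> F" using lr(1) by (simp add: vi_solutions_def)
  obtain c where c: "(\<lambda>k. (norm (x k - l))\<^sup>2) \<longlonglongrightarrow> c" using fejer(1)[OF l] by (auto simp: convergent_def)
  have "(\<lambda>n. (norm (x (q n) - l))\<^sup>2) \<longlonglongrightarrow> (norm (l - l))\<^sup>2" by (intro tendsto_intros xl)
  from LIMSEQ_unique[OF filterlim_compose[OF c q_top] this] have "c = 0" by simp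
  with c have "(\<lambda>k. sqrt ((norm (x k - l))\<^sup>2)) \<longlonglongrightarrow> sqrt 0" by (intro tendsto_intros) simp
  then have "(\<lambda>k. x k - l) \<longlonglongrightarrow> 0" by (simp add: tendsto_norm_zero_iff)
  then have "x \<longlonglongrightarrow> l" by (simp add: LIM_zero_iff)
  then show ?thesis using l by blast
qed

section \<open>Almost sure convergence of series of martingale differences\<close>

locale filtered_prob_space = prob_space M for M :: "'a measure" +
  fixes G :: "nat \<Rightarrow> 'a measure"
  assumes subalg: "\<And>k. subalgebra M (G k)"
    and subalg_Suc: "\<And>k. subalgebra (G (Suc k)) (G k)"
begin

lemma sub_sigma_finite: "sigma_finite_subalgebra M (G k)"
  by (intro finite_measure_subalgebra_is_sigma_finite)
    (simp add: finite_measure_subalgebra_def finite_measure_subalgebra_axioms_def subalg finite_measure_axioms)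

lemma measurable_G_imp_M: "h \<in> measurable (G k) N \<Longrightarrow> h \<in> measurable M N"
  by (rule measurable_from_subalg[OF subalg])

lemma measurable_G_mono:
  assumes "h \<in> measurable (G i) N" "i \<le> j"
  shows "h \<in> measurable (G j) N"
  using assms(2)
proof (induction j rule: dec_induct)
  case (step j)
  then show ?case using measurable_from_subalg[OF subalg_Suc] by blast
qed (rule assms(1))

text \<open>
  Conditional mean zero in tested form: \<open>d k\<close> is orthogonal to every \<open>G k\<close>-measurable \<open>h\<close> for which the
  product is integrable. This form covers differences that become integrable only after a predictable
  truncation, and it is visibly preserved by multiplication with predictable factors.
\<close>

definition martingale_diff :: "(nat \<Rightarrow> 'a \<Rightarrow> real) \<Rightarrow> bool" where
  "martingale_diff d \<longleftrightarrow> (\<forall>k. d k \<in> borel_measurable (G (Suc k))) \<and>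
     (\<forall>k h. h \<in> borel_measurable (G k) \<longrightarrow> integrable M (\<lambda>\<omega>. h \<omega> * d k \<omega>) \<longrightarrow>
        (\<integral>\<omega>. h \<omega> * d k \<omega> \<partial>M) = 0)"

lemma martingale_diff_measurable_G:
  "martingale_diff d \<Longrightarrow> k < n \<Longrightarrow> d k \<in> borel_measurable (G n)"
  using measurable_G_mono[of "d k" "Suc k" borel n] by (auto simp: martingale_diff_def)

lemma martingale_diff_measurable: "martingale_diff d \<Longrightarrow> d k \<in> borel_measurable M"
  using martingale_diff_measurable_G[of d k "Suc k"] measurable_G_imp_M by blast

lemma martingale_diffI:
  assumes d: "\<And>k. d k \<in> borel_measurable (G (Suc k))"
    and zero: "\<And>k. AE \<omega> in M. real_cond_exp M (G k) (d k) \<omega> = 0"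
  shows "martingale_diff d"
  unfolding martingale_diff_def
proof (intro conjI allI impI d)
  fix k h assume h: "h \<in> borel_measurable (G k)" "integrable M (\<lambda>\<omega>. h \<omega> * d k \<omega>)"
  interpret S: sigma_finite_subalgebra M "G k" by (rule sub_sigma_finite)
  have "(\<integral>\<omega>. h \<omega> * d k \<omega> \<partial>M) = (\<integral>\<omega>. h \<omega> * real_cond_exp M (G k) (d k) \<omega> \<partial>M)"
    using S.real_cond_exp_intg(2)[OF h(2,1) measurable_G_imp_M[OF d]] by simp
  also have "\<dots> = (\<integral>\<omega>. 0 \<partial>M)"
    using zero[of k] measurable_G_imp_M[OF h(1)] by (intro integral_cong_AE) auto
  finally show "(\<integral>\<omega>. h \<omega> * d k \<omega> \<partial>M) = 0" by simp
qed

lemma martingale_diff_mult: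
  assumes "martingale_diff d" "\<And>k. H k \<in> borel_measurable (G k)"
  shows "martingale_diff (\<lambda>k \<omega>. H k \<omega> * d k \<omega>)"
  unfolding martingale_diff_def
proof (intro conjI allI impI)
  fix k
  show "(\<lambda>\<omega>. H k \<omega> * d k \<omega>) \<in> borel_measurable (G (Suc k))"
    using martingale_diff_measurable_G[OF assms(1), of k "Suc k"]
      measurable_G_mono[OF assms(2), of k "Suc k"]
    by (intro borel_measurable_times) auto
next
  fix k h assume "h \<in> borel_measurable (G k)" "integrable M (\<lambda>\<omega>. h \<omega> * (H k \<omega> * d k \<omega>))"
  then show "(\<integral>\<omega>. h \<omega> * (H k \<omega> * d k \<omega>) \<partial>M) = 0"
    using assms borel_measurable_times[of h "G k" "H k"]
    unfolding martingale_diff_def mult.assoc[symmetric] by blast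
qed

text \<open>
  Pythagoras: each increment is orthogonal to the sum of the earlier ones.
\<close>

lemma martingale_diff_sum_square:
  assumes d: "martingale_diff d" and sq: "\<And>k. integrable M (\<lambda>\<omega>. (d k \<omega>)\<^sup>2)"
  shows "integrable M (\<lambda>\<omega>. (\<Sum>k<n. d k \<omega>)\<^sup>2) \<and>
    (\<integral>\<omega>. (\<Sum>k<n. d k \<omega>)\<^sup>2 \<partial>M) = (\<Sum>k<n. \<integral>\<omega>. (d k \<omega>)\<^sup>2 \<partial>M)"
proof (induction n)
  case (Suc n)
  let ?S = "\<lambda>\<omega>. \<Sum>k<n. d k \<omega>"
  have S: "?S \<in> borel_measurable (G n)"
    using martingale_diff_measurable_G[OF d] by (intro borel_measurable_sum) auto
  have prod: "integrable M (\<lambda>\<omega>. ?S \<omega> * d n \<omega>)"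
  proof (rule Bochner_Integration.integrable_bound)
    show "integrable M (\<lambda>\<omega>. (?S \<omega>)\<^sup>2 + (d n \<omega>)\<^sup>2)" using Suc sq by simp
    show "(\<lambda>\<omega>. ?S \<omega> * d n \<omega>) \<in> borel_measurable M"
      using measurable_G_imp_M[OF S] martingale_diff_measurable[OF d] by measurable
    have "\<bar>a * b\<bar> \<le> a\<^sup>2 + b\<^sup>2" for a b :: real
      using sum_squares_bound[of "\<bar>a\<bar>" "\<bar>b\<bar>"] mult_nonneg_nonneg[of "\<bar>a\<bar>" "\<bar>b\<bar>"]
      unfolding abs_mult power2_abs mult.assoc by linarith
    then show "AE \<omega> in M. norm (?S \<omega> * d n \<omega>) \<le> norm ((?S \<omega>)\<^sup>2 + (d n \<omega>)\<^sup>2)" by simp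
  qed
  then have "(\<integral>\<omega>. ?S \<omega> * d n \<omega> \<partial>M) = 0" using d S by (auto simp: martingale_diff_def)
  moreover have "(\<Sum>k<Suc n. d k \<omega>)\<^sup>2 = (?S \<omega>)\<^sup>2 + 2 * (?S \<omega> * d n \<omega>) + (d n \<omega>)\<^sup>2" for \<omega>
    by (simp add: power2_eq_square algebra_simps)
  ultimately show ?case using Suc sq prod by simp
qed simp

text \<open>
  The sum \<open>T\<close> stopped at the first crossing of the level \<open>c\<close> still has modulus at least \<open>c\<close> at time \<open>N\<close>
  if a crossing occurred. It is obtained from \<open>d\<close> by a predictable \<open>0\<close>-\<open>1\<close> factor \<open>H\<close>, so Pythagoras
  bounds its second moment and Chebyshev's inequality applies to \<open>T\<close> alone.
\<close>

lemma maximal_inequality: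
  assumes d: "martingale_diff d" and sq: "\<And>k. integrable M (\<lambda>\<omega>. (d k \<omega>)\<^sup>2)" and c: "0 < c"
  shows "prob {\<omega>\<in>space M. \<exists>n\<in>{m..N}. c \<le> \<bar>\<Sum>k=m..<n. d k \<omega>\<bar>}
    \<le> (\<Sum>k=m..<N. \<integral>\<omega>. (d k \<omega>)\<^sup>2 \<partial>M) / c\<^sup>2"
proof -
  define S where "S n \<omega> = (\<Sum>k=m..<n. d k \<omega>)" for n \<omega>
  define H :: "nat \<Rightarrow> 'a \<Rightarrow> real" where
    "H k \<omega> = (if m \<le> k \<and> (\<forall>n\<in>{m..k}. \<bar>S n \<omega>\<bar> < c) then 1 else 0)" for k \<omega>
  define T where "T \<omega> = (\<Sum>k<N. H k \<omega> * d k \<omega>)" for \<omega>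
  have S_meas: "S n \<in> borel_measurable (G k)" if "n \<le> k" for n k
    unfolding S_def using martingale_diff_measurable_G[OF d] that by (intro borel_measurable_sum) auto
  have H_meas: "H k \<in> borel_measurable (G k)" for k
  proof -
    have [measurable]: "S n \<in> borel_measurable (G k)" if "n \<in> {m..k}" for n using S_meas that by auto
    show ?thesis unfolding H_def by measurable
  qed
  have [measurable]: "d k \<in> borel_measurable M" "H k \<in> borel_measurable M" for k
    using martingale_diff_measurable[OF d] measurable_G_imp_M[OF H_meas] by auto
  have [measurable]: "T \<in> borel_measurable M" unfolding T_def by measurable
  have Hd: "martingale_diff (\<lambda>k \<omega>. H k \<omega> * d k \<omega>)" using d H_meas by (rule martingale_diff_mult)
  have Hd_le: "(H k \<omega> * d k \<omega>)\<^sup>2 \<le> (d k \<omega>)\<^sup>2" for k \<omega> by (simp add: H_def)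
  have Hd_sq: "integrable M (\<lambda>\<omega>. (H k \<omega> * d k \<omega>)\<^sup>2)" for k
    by (rule Bochner_Integration.integrable_bound[OF sq[of k]]) (use Hd_le in auto)
  have T_int: "integrable M (\<lambda>\<omega>. (T \<omega>)\<^sup>2)"
    and "(\<integral>\<omega>. (T \<omega>)\<^sup>2 \<partial>M) = (\<Sum>k<N. \<integral>\<omega>. (H k \<omega> * d k \<omega>)\<^sup>2 \<partial>M)"
    using martingale_diff_sum_square[OF Hd Hd_sq, of N] by (auto simp: T_def)
  note this(2)
  also have "\<dots> = (\<Sum>k=m..<N. \<integral>\<omega>. (H k \<omega> * d k \<omega>)\<^sup>2 \<partial>M)"
    by (rule sum.mono_neutral_right) (auto simp: H_def)
  also have "\<dots> \<le> (\<Sum>k=m..<N. \<integral>\<omega>. (d k \<omega>)\<^sup>2 \<partial>M)"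
    by (intro sum_mono integral_mono Hd_sq sq Hd_le)
  finally have ET: "(\<integral>\<omega>. (T \<omega>)\<^sup>2 \<partial>M) \<le> (\<Sum>k=m..<N. \<integral>\<omega>. (d k \<omega>)\<^sup>2 \<partial>M)" .
  have stopped: "c\<^sup>2 \<le> (T \<omega>)\<^sup>2" if ex: "\<exists>n\<in>{m..N}. c \<le> \<bar>S n \<omega>\<bar>" for \<omega>
  proof -
    define n where "n = (LEAST n. m \<le> n \<and> c \<le> \<bar>S n \<omega>\<bar>)"
    obtain i where i: "m \<le> i \<and> c \<le> \<bar>S i \<omega>\<bar>" "i \<le> N" using ex by auto
    have n: "m \<le> n" "c \<le> \<bar>S n \<omega>\<bar>" using LeastI[of "\<lambda>n. m \<le> n \<and> c \<le> \<bar>S n \<omega>\<bar>" i, OF i(1)] unfolding n_def by auto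
    have "n \<le> N" using Least_le[of "\<lambda>n. m \<le> n \<and> c \<le> \<bar>S n \<omega>\<bar>" i, OF i(1)] i(2) unfolding n_def by simp
    have before: "\<bar>S k \<omega>\<bar> < c" if "m \<le> k" "k < n" for k
      using not_less_Least[of k "\<lambda>n. m \<le> n \<and> c \<le> \<bar>S n \<omega>\<bar>"] that unfolding n_def by auto
    have "H k \<omega> = (if k \<in> {m..<n} then 1 else 0)" for k
    proof (cases "k < n")
      case True
      then show ?thesis using before by (auto simp: H_def)
    next
      case False
      then have "\<not> (\<forall>j\<in>{m..k}. \<bar>S j \<omega>\<bar> < c)" using n by (meson atLeastAtMost_iff not_less)
      then show ?thesis using False by (simp add: H_def)
    qed
    then have "T \<omega> = (\<Sum>k\<in>{..<N}. if k \<in> {m..<n} then d k \<omega> else 0)"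
      unfolding T_def by (intro sum.cong) auto
    also have "\<dots> = (\<Sum>k\<in>{..<N} \<inter> {m..<n}. d k \<omega>)" by (rule sum.inter_restrict[symmetric]) simp
    also have "{..<N} \<inter> {m..<n} = {m..<n}" using \<open>n \<le> N\<close> by auto
    finally have "T \<omega> = S n \<omega>" by (simp add: S_def)
    then show ?thesis using n(2) c by (metis abs_le_square_iff abs_of_pos)
  qed
  have "prob {\<omega>\<in>space M. \<exists>n\<in>{m..N}. c \<le> \<bar>S n \<omega>\<bar>} \<le> prob {\<omega>\<in>space M. c\<^sup>2 \<le> (T \<omega>)\<^sup>2}"
    using stopped by (intro finite_measure_mono) auto
  also have "\<dots> \<le> (\<integral>\<omega>. (T \<omega>)\<^sup>2 \<partial>M) / c\<^sup>2"
    by (rule integral_Markov_inequality_measure[OF T_int, of "{}"]) (use c in auto)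
  also have "\<dots> \<le> (\<Sum>k=m..<N. \<integral>\<omega>. (d k \<omega>)\<^sup>2 \<partial>M) / c\<^sup>2"
    using ET by (intro divide_right_mono) auto
  finally show ?thesis by (simp add: S_def)
qed

text \<open>
  By the maximal inequality the probability that the partial sums after time \<open>m\<close> oscillate by \<open>c\<close> or
  more is at most the variance still to come divided by \<open>c\<^sup>2\<close>, which tends to \<open>0\<close>. So almost every
  path is Cauchy.
\<close>

lemma martingale_diff_summable_L2:
  assumes d: "martingale_diff d" and sq: "\<And>k. integrable M (\<lambda>\<omega>. (d k \<omega>)\<^sup>2)"
    and sum: "summable (\<lambda>k. \<integral>\<omega>. (d k \<omega>)\<^sup>2 \<partial>M)"
  shows "AE \<omega> in M. summable (\<lambda>k. d k \<omega>)"
proof -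
  define v where "v k = (\<integral>\<omega>. (d k \<omega>)\<^sup>2 \<partial>M)" for k
  have v0: "0 \<le> v k" for k by (simp add: v_def)
  have [measurable]: "d k \<in> borel_measurable M" for k by (rule martingale_diff_measurable[OF d])
  have osc: "AE \<omega> in M. \<exists>m. \<forall>n\<ge>m. \<bar>\<Sum>k=m..<n. d k \<omega>\<bar> < c" if c: "0 < c" for c :: real
  proof -
    define E where "E m = {\<omega>\<in>space M. \<exists>n\<ge>m. c \<le> \<bar>\<Sum>k=m..<n. d k \<omega>\<bar>}" for m
    have [measurable]: "E m \<in> events" for m unfolding E_def by measurable
    have E_le: "prob (E m) \<le> (\<Sum>k. v (k + m)) / c\<^sup>2" for m
    proof -
      \<comment> \<open>The maximal inequality covers finite horizons; continuity of the measure from below removes the horizon.\<close>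
      define B where "B N = {\<omega>\<in>space M. \<exists>n\<in>{m..N}. c \<le> \<bar>\<Sum>k=m..<n. d k \<omega>\<bar>}" for N
      have [measurable]: "B N \<in> events" for N unfolding B_def by measurable
      have "incseq B" unfolding incseq_Suc_iff B_def by auto
      then have lim: "(\<lambda>N. prob (B N)) \<longlonglongrightarrow> prob (\<Union>N. B N)"
        by (intro finite_Lim_measure_incseq) auto
      have "\<omega> \<in> (\<Union>N. B N)" if \<omega>: "\<omega> \<in> E m" for \<omega>
      proof -
        obtain n where "m \<le> n" "c \<le> \<bar>\<Sum>k=m..<n. d k \<omega>\<bar>" using \<omega> by (auto simp: E_def)
        then have "\<omega> \<in> B n" using \<omega> by (auto simp: E_def B_def intro!: bexI[of _ n])
        then show ?thesis by blast
      qed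
      moreover have "B N \<subseteq> E m" for N unfolding B_def E_def by auto
      ultimately have UN: "(\<Union>N. B N) = E m" by blast
      have "prob (B N) \<le> (\<Sum>k. v (k + m)) / c\<^sup>2" for N
      proof -
        have "(\<Sum>k=m..<N. v k) \<le> (\<Sum>k. v (k + m))"
        proof (cases "m \<le> N")
          case True
          then have "(\<Sum>k=m..<N. v k) = (\<Sum>k<N - m. v (k + m))"
            using sum.shift_bounds_nat_ivl[of v 0 m "N - m"] by (simp add: atLeast0LessThan)
          also have "\<dots> \<le> (\<Sum>k. v (k + m))"
            using sum v0 by (intro sum_le_suminf) (auto simp: v_def summable_iff_shift[of v] intro: summable_ignore_initial_segment)
          finally show ?thesis .
        next
          case False
          then show ?thesis using sum v0
            by (auto simp: v_def intro!: suminf_nonneg summable_ignore_initial_segment[of "\<lambda>k. \<integral>\<omega>. (d k \<omega>)\<^sup>2 \<partial>M"])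
        qed
        then show ?thesis using maximal_inequality[OF d sq c, of m N] c
          unfolding B_def v_def[symmetric] by (meson divide_right_mono order_trans zero_le_power2)
      qed
      then show ?thesis using LIMSEQ_le_const2[OF lim] UN by auto
    qed
    have "(\<lambda>m. (\<Sum>k. v (k + m)) / c\<^sup>2) \<longlonglongrightarrow> 0 / c\<^sup>2"
    proof (intro tendsto_divide tendsto_const)
      have "summable v" using sum by (simp add: v_def[abs_def])
      then have "(\<lambda>m. suminf v - (\<Sum>k<m. v k)) \<longlonglongrightarrow> suminf v - suminf v"
        by (intro tendsto_intros summable_LIMSEQ)
      then show "(\<lambda>m. \<Sum>k. v (k + m)) \<longlonglongrightarrow> 0"
        using suminf_minus_initial_segment[OF \<open>summable v\<close>] by simp
    qed (use c in simp)
    moreover have "prob (\<Inter>m. E m) \<le> (\<Sum>k. v (k + m)) / c\<^sup>2" for m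
      using E_le[of m] finite_measure_mono[of "\<Inter>m. E m" "E m"] by fastforce
    ultimately have "prob (\<Inter>m. E m) \<le> 0 / c\<^sup>2" by (intro LIMSEQ_le_const) auto
    then have "prob (\<Inter>m. E m) = 0" by (simp add: measure_le_0_iff)
    then have "AE \<omega> in M. \<omega> \<notin> (\<Inter>m. E m)" by (subst (asm) prob_eq_0) auto
    then show ?thesis using AE_space
    proof eventually_elim
      case (elim \<omega>)
      then obtain m where "\<omega> \<notin> E m" by blast
      then show ?case using elim(2) unfolding E_def by (intro exI[of _ m]) (force simp: not_le)
    qed
  qed
  have "AE \<omega> in M. \<forall>r::nat. \<exists>m. \<forall>n\<ge>m. \<bar>\<Sum>k=m..<n. d k \<omega>\<bar> < 1 / Suc r"
    unfolding AE_all_countable by (intro allI osc) simp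
  then show ?thesis
  proof eventually_elim
    case (elim \<omega>)
    have "Cauchy (\<lambda>n. \<Sum>k<n. d k \<omega>)"
    proof (rule metric_CauchyI)
      fix e :: real assume "0 < e"
      then obtain r where r: "1 / real (Suc r) < e / 2" using nat_approx_posE[of "e / 2"] by auto
      obtain m where m: "\<And>n. n \<ge> m \<Longrightarrow> \<bar>\<Sum>k=m..<n. d k \<omega>\<bar> < 1 / Suc r" using elim by blast
      have *: "(\<Sum>k<n. d k \<omega>) = (\<Sum>k<m. d k \<omega>) + (\<Sum>k=m..<n. d k \<omega>)" if "m \<le> n" for n
        using sum.atLeastLessThan_concat[of 0 m n "\<lambda>k. d k \<omega>"] that by (simp add: atLeast0LessThan)
      show "\<exists>m. \<forall>i\<ge>m. \<forall>j\<ge>m. dist (\<Sum>k<i. d k \<omega>) (\<Sum>k<j. d k \<omega>) < e"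
      proof (intro exI[of _ m] allI impI)
        fix i j assume ij: "m \<le> i" "m \<le> j"
        show "dist (\<Sum>k<i. d k \<omega>) (\<Sum>k<j. d k \<omega>) < e"
          using m[OF ij(1)] m[OF ij(2)] r unfolding *[OF ij(1)] *[OF ij(2)] dist_real_def by linarith
      qed
    qed
    then show ?case by (simp add: summable_iff_convergent Cauchy_convergent)
  qed
qed

context
  fixes q :: "nat \<Rightarrow> 'a \<Rightarrow> ennreal"
  assumes q_measurable: "\<And>k. q k \<in> borel_measurable M"
begin

text \<open>
  The event that the conditional expectations accumulated up to and including time \<open>k\<close> do not exceed
  \<open>m\<close>. Including time \<open>k\<close> keeps it \<open>G k\<close>-measurable, since the conditional expectation of \<open>q k\<close> is known
  at that time, and it makes the truncated sum stay below \<open>m\<close> on every path.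
\<close>

definition budget :: "nat \<Rightarrow> nat \<Rightarrow> 'a set" where
  "budget m k = {\<omega> \<in> space M. (\<Sum>j\<le>k. nn_cond_exp M (G j) (q j) \<omega>) \<le> of_nat m}"

lemma budget_in_G: "budget m k \<in> sets (G k)"
proof -
  have [measurable]: "nn_cond_exp M (G j) (q j) \<in> borel_measurable (G k)" if "j \<in> {..k}" for j
    using measurable_G_mono[OF borel_measurable_nn_cond_exp] that by auto
  have "{\<omega> \<in> space (G k). (\<Sum>j\<le>k. nn_cond_exp M (G j) (q j) \<omega>) \<le> of_nat m} \<in> sets (G k)" by measurable
  moreover have "space (G k) = space M" using subalg by (simp add: subalgebra_def)
  ultimately show ?thesis by (simp add: budget_def)
qed

lemma budget_event: "budget m k \<in> events"
  using budget_in_G[of m k] subalg[of k] unfolding subalgebra_def by blast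

text \<open>
  The truncation is predictable, so it can be moved inside the conditional expectation; the resulting
  integrand has total mass at most \<open>m\<close> on each path, because the events decrease in \<open>k\<close> and the
  conditional expectations up to the last one that is kept sum to at most \<open>m\<close>.
\<close>

lemma budget_sum_le: "(\<Sum>k. \<integral>\<^sup>+\<omega>. indicator (budget m k) \<omega> * q k \<omega> \<partial>M) \<le> of_nat m"
proof -
  let ?c = "\<lambda>k. nn_cond_exp M (G k) (q k)"
  have [measurable]: "?c k \<in> borel_measurable M" "budget m k \<in> events" for k
    using measurable_G_imp_M[OF borel_measurable_nn_cond_exp] budget_event by auto
  have "(\<Sum>k. \<integral>\<^sup>+\<omega>. indicator (budget m k) \<omega> * q k \<omega> \<partial>M)
      = (\<Sum>k. \<integral>\<^sup>+\<omega>. indicator (budget m k) \<omega> * ?c k \<omega> \<partial>M)"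
  proof (intro suminf_cong)
    fix k
    interpret S: sigma_finite_subalgebra M "G k" by (rule sub_sigma_finite)
    show "(\<integral>\<^sup>+\<omega>. indicator (budget m k) \<omega> * q k \<omega> \<partial>M) = (\<integral>\<^sup>+\<omega>. indicator (budget m k) \<omega> * ?c k \<omega> \<partial>M)"
      by (rule S.nn_cond_exp_intg[symmetric]) (use budget_in_G q_measurable in auto)
  qed
  also have "\<dots> = (\<integral>\<^sup>+\<omega>. (\<Sum>k. indicator (budget m k) \<omega> * ?c k \<omega>) \<partial>M)"
    by (rule nn_integral_suminf[symmetric]) measurable
  also have "\<dots> \<le> (\<integral>\<^sup>+\<omega>. of_nat m \<partial>M)"
  proof (intro nn_integral_mono)
    fix \<omega>
    have "(\<Sum>k<n. indicator (budget m k) \<omega> * ?c k \<omega>) \<le> of_nat m" for n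
    proof (induction n)
      case (Suc n)
      show ?case
      proof (cases "\<omega> \<in> budget m n")
        case True
        have "(\<Sum>k<Suc n. indicator (budget m k) \<omega> * ?c k \<omega>) \<le> (\<Sum>k<Suc n. ?c k \<omega>)"
          by (intro sum_mono) (simp split: split_indicator)
        also have "\<dots> \<le> of_nat m" using True by (simp add: budget_def lessThan_Suc_atMost)
        finally show ?thesis .
      qed (use Suc in simp)
    qed simp
    then show "(\<Sum>k. indicator (budget m k) \<omega> * ?c k \<omega>) \<le> of_nat m" by (intro suminf_le_const) auto
  qed
  also have "\<dots> = of_nat m" by (simp add: emeasure_space_1)
  finally show ?thesis .
qed

lemma eventually_within_budget:
  assumes "AE \<omega> in M. (\<Sum>k. nn_cond_exp M (G k) (q k) \<omega>) < \<infinity>"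
  shows "AE \<omega> in M. \<exists>m. \<forall>k. \<omega> \<in> budget m k"
  using assms AE_space
proof eventually_elim
  case (elim \<omega>)
  obtain m :: nat where m: "(\<Sum>k. nn_cond_exp M (G k) (q k) \<omega>) < of_nat m"
    using elim(1) ennreal_Ex_less_of_nat by (auto simp: less_top)
  have "(\<Sum>j\<le>k. nn_cond_exp M (G j) (q j) \<omega>) \<le> (\<Sum>k. nn_cond_exp M (G k) (q k) \<omega>)" for k
    by (intro sum_le_suminf) auto
  then have "(\<Sum>j\<le>k. nn_cond_exp M (G j) (q j) \<omega>) \<le> of_nat m" for k
    using m by (meson le_less_trans less_imp_le)
  then show ?case using elim(2) by (auto simp: budget_def)
qed

text \<open>
  Within each budget the truncated sum has finite expectation and is therefore finite almost surely;
  the budgets exhaust the space up to a null set.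
\<close>

lemma suminf_finite_if_conditional_sum_finite:
  assumes "AE \<omega> in M. (\<Sum>k. nn_cond_exp M (G k) (q k) \<omega>) < \<infinity>"
  shows "AE \<omega> in M. (\<Sum>k. q k \<omega>) < \<infinity>"
proof -
  note [measurable] = q_measurable budget_event
  have "AE \<omega> in M. (\<Sum>k. indicator (budget m k) \<omega> * q k \<omega>) \<noteq> \<infinity>" for m
  proof (rule nn_integral_PInf_AE)
    have "(\<integral>\<^sup>+\<omega>. (\<Sum>k. indicator (budget m k) \<omega> * q k \<omega>) \<partial>M) \<le> of_nat m"
      using budget_sum_le[of m] by (subst nn_integral_suminf) auto
    then show "(\<integral>\<^sup>+\<omega>. (\<Sum>k. indicator (budget m k) \<omega> * q k \<omega>) \<partial>M) \<noteq> \<infinity>" by (auto simp: top_unique)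
  qed measurable
  then have "AE \<omega> in M. \<forall>m. (\<Sum>k. indicator (budget m k) \<omega> * q k \<omega>) \<noteq> \<infinity>"
    by (simp add: AE_all_countable)
  then show ?thesis using eventually_within_budget[OF assms]
  proof eventually_elim
    case (elim \<omega>)
    then obtain m where "\<And>k. \<omega> \<in> budget m k" by blast
    then show ?case using elim(1)[rule_format, of m] by (simp add: less_top)
  qed
qed

end

text \<open>
  Localisation: truncated to the budget \<open>m\<close>, the differences have total variance at most \<open>m\<close>, so their
  series converges almost surely; almost every path stays within some budget for ever and there the
  truncation changes nothing.
\<close>

lemma martingale_diff_summable:
  assumes d: "martingale_diff d"
    and fin: "AE \<omega> in M. (\<Sum>k. nn_cond_exp M (G k) (\<lambda>\<omega>. ennreal ((d k \<omega>)\<^sup>2)) \<omega>) < \<infinity>"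
  shows "AE \<omega> in M. summable (\<lambda>k. d k \<omega>)"
proof -
  let ?q = "\<lambda>k \<omega>. ennreal ((d k \<omega>)\<^sup>2)"
  have [measurable]: "d k \<in> borel_measurable M" for k by (rule martingale_diff_measurable[OF d])
  then have q: "?q k \<in> borel_measurable M" for k by measurable
  have [measurable]: "budget ?q m k \<in> events" for m k
    using budget_event[of ?q, OF q] .
  have "AE \<omega> in M. summable (\<lambda>k. indicator (budget ?q m k) \<omega> * d k \<omega>)" for m
  proof (rule martingale_diff_summable_L2)
    let ?e = "\<lambda>k \<omega>. indicator (budget ?q m k) \<omega> * d k \<omega>"
    show "martingale_diff ?e"
      by (rule martingale_diff_mult[OF d]) (use budget_in_G[of ?q, OF q] in auto)
    have eq: "ennreal ((?e k \<omega>)\<^sup>2) = indicator (budget ?q m k) \<omega> * ?q k \<omega>" for k \<omega>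
      by (simp split: split_indicator)
    have le: "(\<Sum>k. \<integral>\<^sup>+\<omega>. ennreal ((?e k \<omega>)\<^sup>2) \<partial>M) \<le> of_nat m"
      unfolding eq using budget_sum_le[of ?q, OF q] .
    have fin: "(\<integral>\<^sup>+\<omega>. ennreal ((?e k \<omega>)\<^sup>2) \<partial>M) < \<infinity>" for k
    proof -
      have "(\<integral>\<^sup>+\<omega>. ennreal ((?e k \<omega>)\<^sup>2) \<partial>M) \<le> (\<Sum>k. \<integral>\<^sup>+\<omega>. ennreal ((?e k \<omega>)\<^sup>2) \<partial>M)"
        using sum_le_suminf[of "\<lambda>k. \<integral>\<^sup>+\<omega>. ennreal ((?e k \<omega>)\<^sup>2) \<partial>M" "{k}"] by simp
      also note le
      also have "(of_nat m :: ennreal) < \<infinity>" by (simp add: of_nat_less_top)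
      finally show ?thesis .
    qed
    show int: "integrable M (\<lambda>\<omega>. (?e k \<omega>)\<^sup>2)" for k
      by (rule integrableI_nonneg) (use fin[of k] in auto)
    have "(\<Sum>k. ennreal (\<integral>\<omega>. (?e k \<omega>)\<^sup>2 \<partial>M)) \<le> of_nat m"
      using le by (subst (asm) nn_integral_eq_integral[OF int]) auto
    then show "summable (\<lambda>k. \<integral>\<omega>. (?e k \<omega>)\<^sup>2 \<partial>M)"
      by (intro summable_suminf_not_top) (auto simp: top_unique)
  qed
  then have "AE \<omega> in M. \<forall>m. summable (\<lambda>k. indicator (budget ?q m k) \<omega> * d k \<omega>)"
    by (simp add: AE_all_countable)
  then show ?thesis using eventually_within_budget[of ?q, OF q fin]
  proof eventually_elim
    case (elim \<omega>)
    then obtain m where "\<And>k. \<omega> \<in> budget ?q m k" by blast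
    then show ?case using elim(1)[rule_format, of m] by simp
  qed
qed

end

section \<open>Coordinate blocks\<close>

lemma block_nth [simp]: "block own i x $ j = (if own j = i then x $ j else 0)"
  by (simp add: block_def)

lemma col_nth [simp]: "col own v $ j = v (own j) $ j"
  by (simp add: col_def)

lemma with_block_nth [simp]: "with_block own i u x $ j = (if own j = i then u $ j else x $ j)"
  by (simp add: with_block_def)

lemma linear_block: "linear (block own i :: real ^ 'n::finite \<Rightarrow> _)"
  by (intro linearI) (auto simp: vec_eq_iff)

lemma continuous_on_block: "continuous_on S (block own i :: real ^ 'n::finite \<Rightarrow> _)"
  using linear_block by (rule linear_continuous_on[OF linear_conv_bounded_linear[THEN iffD1]])

lemma sum_blocks:
  fixes own :: "'n::finite \<Rightarrow> 'i::finite"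
  shows "(\<Sum>i\<in>UNIV. block own i x) = x"
  by (simp add: vec_eq_iff sum.delta' cong: if_cong)

lemma inner_eq_sum_blocks:
  fixes own :: "'n::finite \<Rightarrow> 'i::finite"
  shows "u \<bullet> v = (\<Sum>i\<in>UNIV. u \<bullet> block own i v)"
  by (simp flip: inner_sum_right add: sum_blocks)

text \<open>
  Against a vector supported in block \<open>i\<close> only the coordinates of that block are seen; this is what
  makes the proximal inequalities of the agents add up to the joint one.
\<close>

lemma inner_block_cong:
  fixes u u' v :: "real ^ 'n::finite"
  assumes "\<And>j. own j = i \<Longrightarrow> u $ j = u' $ j"
  shows "u \<bullet> block own i v = u' \<bullet> block own i v"
  unfolding inner_vec_def by (rule sum.cong) (auto simp: assms)

lemma borel_measurable_vecI:
  fixes h :: "'w \<Rightarrow> real ^ 'n::finite"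
  assumes "\<And>j. (\<lambda>\<omega>. h \<omega> $ j) \<in> borel_measurable N"
  shows "h \<in> borel_measurable N"
  by (subst borel_measurable_euclidean_space) (auto simp: Basis_vec_def inner_axis assms)

lemma borel_measurable_nth:
  fixes h :: "'w \<Rightarrow> ('b::topological_space) ^ 'n::finite"
  assumes "h \<in> borel_measurable N"
  shows "(\<lambda>\<omega>. h \<omega> $ j) \<in> borel_measurable N"
  using measurable_compose[OF assms borel_measurable_continuous_onI, of "\<lambda>v. v $ j"]
  by (simp add: continuous_on_component)

section \<open>Measurability of partial gradients\<close>

lemma grad_direction_limit:
  fixes h :: "'a::real_inner \<Rightarrow> real"
  assumes "GDERIV h x :> grad h x"
  shows "(\<lambda>n. (h (x + (1 / real (Suc n)) *\<^sub>R a) - h x) * real (Suc n)) \<longlonglongrightarrow> grad h x \<bullet> a"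
proof -
  have "((\<lambda>t. x + t *\<^sub>R a) has_derivative (\<lambda>t. t *\<^sub>R a)) (at (0::real))"
    by (auto intro!: derivative_eq_intros)
  moreover have "(h has_derivative (\<lambda>v. v \<bullet> grad h x)) (at (x + (0::real) *\<^sub>R a))"
    using assms by (simp add: gderiv_def)
  ultimately have "((\<lambda>t. h (x + t *\<^sub>R a)) has_derivative (\<lambda>t. (t *\<^sub>R a) \<bullet> grad h x)) (at (0::real))"
    by (rule has_derivative_compose)
  then have "((\<lambda>t. h (x + t *\<^sub>R a)) has_field_derivative (grad h x \<bullet> a)) (at 0)"
    unfolding has_field_derivative_def by (simp add: inner_commute mult_commute_abs)
  then have lim: "((\<lambda>t. (h (x + t *\<^sub>R a) - h x) / t) \<longlongrightarrow> grad h x \<bullet> a) (at 0)"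
    by (simp add: DERIV_def)
  have "filterlim (\<lambda>n. 1 / real (Suc n)) (at 0) sequentially"
    unfolding filterlim_at using LIMSEQ_Suc[OF lim_1_over_n] by (auto simp: o_def)
  from filterlim_compose[OF lim this] show ?thesis by simp
qed

text \<open>
  Each component of the partial gradient is a limit of difference quotients of \<open>f\<close> at points which
  depend continuously on \<open>y\<close>. For a coordinate outside block \<open>i\<close> the two points coincide, so that the
  quotients vanish and the same formula holds.
\<close>

lemma partial_grad_measurable:
  fixes own :: "'n::finite \<Rightarrow> 'i"
  assumes f: "(\<lambda>(y, s). f y s) \<in> borel_measurable (borel \<Otimes>\<^sub>M borel)"
    and diff: "\<And>y s. cont_diff (\<lambda>u. f (with_block own i u y) s)"
    and y: "y \<in> borel_measurable N" and s: "s \<in> borel_measurable N"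
  shows "(\<lambda>\<omega>. partial_grad own i (\<lambda>y. f y (s \<omega>)) (y \<omega>)) \<in> borel_measurable N"
proof (rule borel_measurable_vecI)
  fix j
  let ?h = "\<lambda>\<omega> u. f (with_block own i u (y \<omega>)) (s \<omega>)"
  let ?a = "axis j 1 :: real ^ 'n"
  have f': "(\<lambda>\<omega>. f (a (y \<omega>)) (s \<omega>)) \<in> borel_measurable N" if "continuous_on UNIV a" for a
  proof -
    have "(\<lambda>\<omega>. a (y \<omega>)) \<in> borel_measurable N"
      using measurable_compose[OF y borel_measurable_continuous_onI[OF that]] .
    from measurable_compose[OF measurable_Pair[OF this s] f] show ?thesis by simp
  qed
  have cont: "continuous_on UNIV (\<lambda>v. with_block own i (v + t *\<^sub>R ?a) v)" for t
  proof -
    have "with_block own i (v + t *\<^sub>R ?a) v = v + t *\<^sub>R block own i ?a" for v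
      by (simp add: vec_eq_iff)
    then show ?thesis by (simp add: continuous_intros)
  qed
  show "(\<lambda>\<omega>. partial_grad own i (\<lambda>y. f y (s \<omega>)) (y \<omega>) $ j) \<in> borel_measurable N"
  proof (rule borel_measurable_LIMSEQ_real)
    fix \<omega>
    have "GDERIV (?h \<omega>) (y \<omega>) :> grad (?h \<omega>) (y \<omega>)" using diff by (simp add: cont_diff_def)
    from grad_direction_limit[OF this, of ?a]
    show "(\<lambda>n. (?h \<omega> (y \<omega> + (1 / real (Suc n)) *\<^sub>R ?a) - ?h \<omega> (y \<omega> + 0 *\<^sub>R ?a)) * real (Suc n))
        \<longlonglongrightarrow> partial_grad own i (\<lambda>y. f y (s \<omega>)) (y \<omega>) $ j"
      by (simp add: partial_grad_def inner_axis)
  next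
    fix n
    show "(\<lambda>\<omega>. (?h \<omega> (y \<omega> + (1 / real (Suc n)) *\<^sub>R ?a) - ?h \<omega> (y \<omega> + 0 *\<^sub>R ?a)) * real (Suc n))
        \<in> borel_measurable N"
      using f'[OF cont[of "1 / real (Suc n)"]] f'[OF cont[of 0]] by measurable
  qed
qed

lemma sampled_pseudogradient_measurable:
  fixes own :: "'n::finite \<Rightarrow> 'i::finite"
  assumes "\<And>i. (\<lambda>(y, s). f i y s) \<in> borel_measurable (borel \<Otimes>\<^sub>M borel)"
    and "\<And>i y s. cont_diff (\<lambda>u. f i (with_block own i u y) s)"
    and "y \<in> borel_measurable N" and "s \<in> borel_measurable N"
  shows "(\<lambda>\<omega>. sampled_pseudogradient own f (y \<omega>) (s \<omega>)) \<in> borel_measurable N"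
proof (rule borel_measurable_vecI)
  fix j
  have "(\<lambda>\<omega>. partial_grad own (own j) (\<lambda>y. f (own j) y (s \<omega> $ own j)) (y \<omega>)) \<in> borel_measurable N"
    by (rule partial_grad_measurable[OF assms(1-3) borel_measurable_nth[OF assms(4)]])
  then show "(\<lambda>\<omega>. sampled_pseudogradient own f (y \<omega>) (s \<omega>) $ j) \<in> borel_measurable N"
    unfolding sampled_pseudogradient_def col_nth by (rule borel_measurable_nth)
qed

section \<open>The regularisers as one convex function on the product set\<close>

text \<open>
  Outside \<open>K\<close> the objective is infinite, so minimising over \<open>S\<close> amounts to minimising the real function
  over the compact set \<open>K\<close>. A minimiser therefore exists, the choice made by \<open>arg_min_on\<close> is one, and
  every minimiser satisfies the variational characterisation.
\<close>

lemma prox_eq_prox_point: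
  fixes S :: "'a::euclidean_space set" and h :: "'a \<Rightarrow> ereal"
  assumes K: "K \<subseteq> S" "compact K" "convex K" "K \<noteq> {}" "convex_on K \<phi>" "real_lsc_on K \<phi>"
    and fin: "\<And>u. u \<in> K \<Longrightarrow> h u = ereal (\<phi> u)"
    and inf: "\<And>u. u \<in> S \<Longrightarrow> u \<notin> K \<Longrightarrow> h u = \<infinity>"
  shows "prox_point K \<phi> v (prox S h v)"
proof -
  let ?H = "\<lambda>u. h u + ereal ((norm (u - v))\<^sup>2 / 2)"
  let ?R = "\<lambda>u. \<phi> u + (norm (u - v))\<^sup>2 / 2"
  have "continuous_on K (\<lambda>u. (norm (u - v))\<^sup>2 / 2)" by (intro continuous_intros) auto
  then have "real_lsc_on K ?R" by (intro real_lsc_on_add K continuous_on_imp_real_lsc_on)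
  from real_lsc_on_attains_inf[OF K(2,4) this] obtain p where p: "p \<in> K" "\<And>y. y \<in> K \<Longrightarrow> ?R p \<le> ?R y"
    by blast
  have "is_arg_min ?H (\<lambda>u. u \<in> S) p"
    unfolding is_arg_min_def
  proof (intro conjI notI)
    show "p \<in> S" using p K(1) by blast
    assume "\<exists>y. y \<in> S \<and> ?H y < ?H p"
    then obtain y where y: "y \<in> S" "?H y < ?H p" by blast
    show False using y p(2)[of y] fin[OF p(1)] fin[of y] inf[OF y(1)] by (cases "y \<in> K") auto
  qed
  then have min: "is_arg_min ?H (\<lambda>u. u \<in> S) (prox S h v)"
    unfolding prox_def arg_min_on_def arg_min_def by (rule someI)
  let ?q = "prox S h v"
  have qS: "?q \<in> S" and q: "\<not> ?H y < ?H ?q" if "y \<in> S" for y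
    using min that unfolding is_arg_min_def by auto
  have "p \<in> S" using p K(1) by blast
  have qK: "?q \<in> K"
  proof (rule ccontr)
    assume "?q \<notin> K"
    then show False using q[OF \<open>p \<in> S\<close>] inf[OF qS[OF \<open>p \<in> S\<close>]] fin[OF p(1)] by simp
  qed
  show ?thesis
  proof (rule minimiser_imp_prox_point[OF K(3,5) qK])
    fix y assume "y \<in> K"
    then show "?R ?q \<le> ?R y" using q[of y] K(1) fin[OF qK] fin[of y] by auto
  qed
qed

text \<open>
  The part of the game that does not involve the cost functions \<open>f\<^sub>i\<close>: regularisers \<open>g\<^sub>i\<close> with compact
  convex domains \<open>\<Omega>\<^sub>i\<close>.
\<close>

locale block_regularised_game =
  fixes own :: "'n::finite \<Rightarrow> 'i::finite"
    and g :: "'i \<Rightarrow> real ^ 'n \<Rightarrow> ereal"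
    and \<Omega> :: "'i \<Rightarrow> (real ^ 'n) set"
  assumes proper: "\<And>i u. u \<in> block_space own i \<Longrightarrow> g i u \<noteq> -\<infinity>"
    and lsc: "\<And>i. lsc_on (block_space own i) (g i)"
    and cvx: "\<And>i. ereal_convex_on (block_space own i) (g i)"
    and dom: "\<And>i. {u \<in> block_space own i. g i u < \<infinity>} = \<Omega> i"
    and nonempty: "\<And>i. \<Omega> i \<noteq> {}"
    and compact: "\<And>i. compact (\<Omega> i)"
    and convex: "\<And>i. convex (\<Omega> i)"
begin

abbreviation "K \<equiv> joint_set own \<Omega>"

text \<open>
  The real function \<open>\<phi> i\<close> represents \<open>g i\<close> on \<open>\<Omega> i\<close>; elsewhere its values carry no meaning.
\<close>

definition \<phi> :: "'i \<Rightarrow> real ^ 'n \<Rightarrow> real" where "\<phi> i u = real_of_ereal (g i u)"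

definition \<Phi> :: "real ^ 'n \<Rightarrow> real" where "\<Phi> x = (\<Sum>i\<in>UNIV. \<phi> i (block own i x))"

lemma \<Omega>_subset: "\<Omega> i \<subseteq> block_space own i"
  using dom by blast

lemma g_finite: "u \<in> \<Omega> i \<Longrightarrow> g i u = ereal (\<phi> i u)"
  using proper[of u i] dom[of i] by (cases "g i u") (auto simp: \<phi>_def)

lemma g_infinite: "u \<in> block_space own i \<Longrightarrow> u \<notin> \<Omega> i \<Longrightarrow> g i u = \<infinity>"
  using dom[of i] unfolding ereal_infty_less(1) by blast

lemma \<phi>_convex: "convex_on (\<Omega> i) (\<phi> i)"
proof (rule convex_onI)
  fix t u v assume t: "0 < t" "t < (1::real)" and uv: "u \<in> \<Omega> i" "v \<in> \<Omega> i"
  let ?w = "(1 - t) *\<^sub>R u + t *\<^sub>R v"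
  have w: "?w \<in> \<Omega> i" using convex[of i] uv t by (simp add: convexD)
  have "u \<in> block_space own i" "v \<in> block_space own i" using uv \<Omega>_subset by auto
  then have "g i ?w \<le> ereal (1 - t) * g i u + ereal t * g i v"
    using cvx[of i] t unfolding ereal_convex_on_def by auto
  then show "\<phi> i ?w \<le> (1 - t) * \<phi> i u + t * \<phi> i v"
    by (simp add: g_finite[OF w] g_finite[OF uv(1)] g_finite[OF uv(2)])
qed (rule convex)

lemma \<phi>_lsc: "real_lsc_on (\<Omega> i) (\<phi> i)"
  unfolding real_lsc_on_def
proof (intro ballI allI impI)
  fix y c assume y: "y \<in> \<Omega> i" and c: "c < \<phi> i y"
  have "g i y \<le> Liminf (at y within block_space own i) (g i)"
    using lsc[of i] y \<Omega>_subset by (auto simp: lsc_on_def)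
  moreover have "ereal c < g i y" using c g_finite[OF y] by simp
  ultimately have "\<forall>\<^sub>F u in at y within block_space own i. ereal c < g i u"
    unfolding le_Liminf_iff by blast
  then have "\<forall>\<^sub>F u in at y within \<Omega> i. ereal c < g i u"
    using at_le[OF \<Omega>_subset] by (rule filter_leD[rotated])
  moreover have "\<forall>\<^sub>F u in at y within \<Omega> i. u \<in> \<Omega> i" by (simp add: eventually_at_filter)
  ultimately show "\<forall>\<^sub>F u in at y within \<Omega> i. c < \<phi> i u"
    by eventually_elim (simp add: g_finite)
qed

lemma block_K: "block own i ` K \<subseteq> \<Omega> i"
  by (auto simp: joint_set_def)

lemma K_nonempty: "K \<noteq> {}"
proof -
  define u where "u i = (SOME v. v \<in> \<Omega> i)" for i
  have u: "u i \<in> \<Omega> i" for i unfolding u_def using nonempty by (simp add: some_in_eq)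
  have "block own i (col own u) = u i" for i
    using \<Omega>_subset u[of i] by (fastforce simp: vec_eq_iff block_space_def)
  then have "col own u \<in> K" using u by (simp add: joint_set_def)
  then show ?thesis by blast
qed

lemma K_convex: "convex K"
proof -
  have "K = (\<Inter>i. block own i -` \<Omega> i)" by (auto simp: joint_set_def)
  then show ?thesis using convex linear_block by (auto intro!: convex_INT convex_linear_vimage)
qed

lemma K_compact: "compact K"
proof -
  have "K = (\<Inter>i. block own i -` \<Omega> i)" by (auto simp: joint_set_def)
  moreover have "closed (block own i -` \<Omega> i)" for i
    using compact_imp_closed[OF compact] continuous_on_block by (rule closed_vimage)
  ultimately have "closed K" by auto
  moreover have "bounded K"
  proof -
    obtain B where B: "\<And>i u. u \<in> \<Omega> i \<Longrightarrow> norm u \<le> B i"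
      using compact_imp_bounded[OF compact] unfolding bounded_iff by metis
    have "norm x \<le> (\<Sum>i\<in>UNIV. B i)" if "x \<in> K" for x
    proof -
      have "norm x = norm (\<Sum>i\<in>UNIV. block own i x)" by (simp add: sum_blocks)
      also have "\<dots> \<le> (\<Sum>i\<in>UNIV. B i)"
        using that B by (intro sum_norm_le) (auto simp: joint_set_def)
      finally show ?thesis .
    qed
    then show ?thesis by (rule boundedI)
  qed
  ultimately show ?thesis by (simp add: compact_eq_bounded_closed)
qed

lemma \<Phi>_convex: "convex_on K \<Phi>"
proof (rule convex_onI)
  fix t x y assume t: "0 < t" "t < (1::real)" and xy: "x \<in> K" "y \<in> K"
  have "\<phi> i (block own i ((1 - t) *\<^sub>R x + t *\<^sub>R y))
      \<le> (1 - t) * \<phi> i (block own i x) + t * \<phi> i (block own i y)" for i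
  proof -
    have "block own i ((1 - t) *\<^sub>R x + t *\<^sub>R y) = (1 - t) *\<^sub>R block own i x + t *\<^sub>R block own i y"
      by (simp add: vec_eq_iff)
    then show ?thesis using convex_onD[OF \<phi>_convex] t xy by (simp add: joint_set_def)
  qed
  then show "\<Phi> ((1 - t) *\<^sub>R x + t *\<^sub>R y) \<le> (1 - t) * \<Phi> x + t * \<Phi> y"
    unfolding \<Phi>_def sum_distrib_left sum.distrib[symmetric] by (intro sum_mono)
qed (rule K_convex)

lemma \<Phi>_lsc: "real_lsc_on K \<Phi>"
  unfolding \<Phi>_def
  by (intro real_lsc_on_sum real_lsc_on_compose[OF \<phi>_lsc continuous_on_block block_K])

lemma SOL_eq: "SOL own \<Omega> F g = vi_solutions K \<Phi> F"
proof -
  have total: "total own g x = ereal (\<Phi> x)" if "x \<in> K" for x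
    using that g_finite by (simp add: total_def \<Phi>_def joint_set_def)
  show ?thesis unfolding SOL_def vi_solutions_def by (auto simp: total zero_ereal_def)
qed

lemma block_prox_point:
  assumes "0 < c"
  shows "prox_point (\<Omega> i) (\<lambda>u. c * \<phi> i u) v (prox (block_space own i) (\<lambda>u. ereal c * g i u) v)"
  using assms
  by (intro prox_eq_prox_point \<Omega>_subset compact convex nonempty convex_on_cmul \<phi>_convex
      real_lsc_on_cmult \<phi>_lsc) (auto simp: g_finite g_infinite)

text \<open>
  Both the squared distance and \<open>\<Phi>\<close> are sums over the blocks, so the agents' separate proximal steps
  form one proximal step on the product set.
\<close>

lemma joint_prox_point:
  assumes "\<And>i. prox_point (\<Omega> i) (\<lambda>u. c * \<phi> i u) (block own i x - c *\<^sub>R w i) (block own i p)"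
  shows "prox_point K (\<lambda>u. c * \<Phi> u) (x - c *\<^sub>R col own w) p"
  unfolding prox_point_def
proof (intro conjI ballI)
  show "p \<in> K" using assms by (auto simp: prox_point_def joint_set_def)
  fix y assume y: "y \<in> K"
  have "(x - c *\<^sub>R col own w - p) \<bullet> (y - p) = (\<Sum>i\<in>UNIV. (x - c *\<^sub>R col own w - p) \<bullet> block own i (y - p))"
    by (rule inner_eq_sum_blocks)
  also have "\<dots> = (\<Sum>i\<in>UNIV. (block own i x - c *\<^sub>R w i - block own i p) \<bullet> block own i (y - p))"
    by (intro sum.cong refl inner_block_cong) auto
  also have "\<dots> \<le> (\<Sum>i\<in>UNIV. c * \<phi> i (block own i y) - c * \<phi> i (block own i p))"
  proof (intro sum_mono)
    fix i
    have "block own i y \<in> \<Omega> i" using y by (simp add: joint_set_def)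
    then show "(block own i x - c *\<^sub>R w i - block own i p) \<bullet> block own i (y - p)
        \<le> c * \<phi> i (block own i y) - c * \<phi> i (block own i p)"
      using assms[of i] unfolding prox_point_def linear_diff[OF linear_block] by blast
  qed
  also have "\<dots> = c * \<Phi> y - c * \<Phi> p" by (simp add: \<Phi>_def sum_subtractf sum_distrib_left)
  finally show "(x - c *\<^sub>R col own w - p) \<bullet> (y - p) \<le> c * \<Phi> y - c * \<Phi> p" .
qed

lemma continuous_on_prox:
  assumes "0 < c"
  shows "continuous_on UNIV (prox (block_space own i) (\<lambda>u. ereal c * g i u))"
proof -
  have "1-lipschitz_on UNIV (prox (block_space own i) (\<lambda>u. ereal c * g i u))"
    using prox_point_nonexpansive[OF block_prox_point[OF assms] block_prox_point[OF assms]]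
    by (intro lipschitz_onI) (auto simp: dist_norm)
  then show ?thesis by (rule lipschitz_on_continuous_on)
qed

end

section \<open>The filtration of the past\<close>

context
  fixes M :: "'w measure" and x0 :: "'w \<Rightarrow> 'x::topological_space"
    and \<zeta> :: "nat \<Rightarrow> 'w \<Rightarrow> 'y::topological_space"
begin

lemma space_history [simp]: "space (history M x0 \<zeta> k) = space M"
  unfolding history_def by (intro space_measure_of) auto

lemma sets_history: "sets (history M x0 \<zeta> k) = sigma_sets (space M)
     ({x0 -` A \<inter> space M | A. A \<in> sets borel} \<union> (\<Union>j<k. {\<zeta> j -` A \<inter> space M | A. A \<in> sets borel}))"
  unfolding history_def by (intro sets_measure_of) auto

lemma initial_measurable_history: "x0 \<in> borel_measurable (history M x0 \<zeta> k)"
  by (rule measurableI) (auto simp: sets_history)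

lemma sample_measurable_history: "j < k \<Longrightarrow> \<zeta> j \<in> borel_measurable (history M x0 \<zeta> k)"
  by (rule measurableI) (auto simp: sets_history)

lemma subalgebra_history_Suc: "subalgebra (history M x0 \<zeta> (Suc k)) (history M x0 \<zeta> k)"
  unfolding subalgebra_def sets_history space_history
  by (intro conjI sigma_sets_mono' refl Un_mono UN_mono) auto

lemma subalgebra_history:
  assumes "x0 \<in> borel_measurable M" "\<And>j. \<zeta> j \<in> borel_measurable M"
  shows "subalgebra M (history M x0 \<zeta> k)"
  unfolding subalgebra_def sets_history space_history
  using assms by (intro conjI refl sets.sigma_sets_subset) (auto intro: measurable_sets)

end

section \<open>Summability of the sampling errors\<close>

context filtered_prob_space
begin

text \<open>
  Used with the weight \<open>1\<close> and with the coordinates of the iterate, which are predictable and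
  bounded; together they handle \<open>\<langle>e k, x k - z\<rangle>\<close> for an arbitrary \<open>z\<close>.
\<close>

lemma weighted_errors_summable:
  fixes e :: "nat \<Rightarrow> 'a \<Rightarrow> real ^ 'n::finite" and \<gamma> :: "nat \<Rightarrow> real"
  assumes e: "\<And>k. e k \<in> borel_measurable (G (Suc k))"
    and unbiased: "\<And>k. AE \<omega> in M. real_cond_exp M (G k) (\<lambda>\<omega>. e k \<omega> $ j) \<omega> = 0"
    and var: "AE \<omega> in M. (\<Sum>k. ennreal ((\<gamma> k)\<^sup>2) *
        nn_cond_exp M (G k) (\<lambda>\<omega>. ennreal ((norm (e k \<omega>))\<^sup>2)) \<omega>) < \<infinity>"
    and w: "\<And>k. w k \<in> borel_measurable (G k)" "\<And>k \<omega>. \<omega> \<in> space M \<Longrightarrow> \<bar>w k \<omega>\<bar> \<le> B"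
  shows "AE \<omega> in M. summable (\<lambda>k. \<gamma> k * w k \<omega> * e k \<omega> $ j)"
proof (rule martingale_diff_summable)
  show "martingale_diff (\<lambda>k \<omega>. \<gamma> k * w k \<omega> * e k \<omega> $ j)"
    by (intro martingale_diff_mult martingale_diffI unbiased borel_measurable_nth e
        borel_measurable_times w borel_measurable_const)
  have eM: "e k \<in> borel_measurable M" and wM: "w k \<in> borel_measurable M" for k
    using measurable_G_imp_M e w by blast+
  note [measurable] = eM wM borel_measurable_nth[OF eM]
  have "AE \<omega> in M. \<forall>k. nn_cond_exp M (G k) (\<lambda>\<omega>. ennreal ((\<gamma> k * w k \<omega> * e k \<omega> $ j)\<^sup>2)) \<omega>
      \<le> ennreal (B\<^sup>2) * (ennreal ((\<gamma> k)\<^sup>2) * nn_cond_exp M (G k) (\<lambda>\<omega>. ennreal ((norm (e k \<omega>))\<^sup>2)) \<omega>)"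
    unfolding AE_all_countable
  proof
    fix k
    interpret S: sigma_finite_subalgebra M "G k" by (rule sub_sigma_finite)
    let ?q = "\<lambda>\<omega>. ennreal ((norm (e k \<omega>))\<^sup>2)"
    let ?c = "ennreal (B\<^sup>2 * (\<gamma> k)\<^sup>2)"
    have "AE \<omega> in M. nn_cond_exp M (G k) (\<lambda>\<omega>. ennreal ((\<gamma> k * w k \<omega> * e k \<omega> $ j)\<^sup>2)) \<omega>
        \<le> nn_cond_exp M (G k) (\<lambda>\<omega>. ?c * ?q \<omega>) \<omega>"
    proof (rule S.nn_cond_exp_mono)
      show "AE \<omega> in M. ennreal ((\<gamma> k * w k \<omega> * e k \<omega> $ j)\<^sup>2) \<le> ?c * ?q \<omega>"
        using AE_space
      proof eventually_elim
        case (elim \<omega>)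
        have "(w k \<omega>)\<^sup>2 \<le> B\<^sup>2" using w(2)[OF elim, of k] by (metis abs_ge_zero power2_abs power_mono)
        moreover have "(e k \<omega> $ j)\<^sup>2 \<le> (norm (e k \<omega>))\<^sup>2"
          using component_le_norm_cart[of "e k \<omega>" j] by (metis abs_ge_zero power2_abs power_mono)
        ultimately have "(w k \<omega>)\<^sup>2 * (e k \<omega> $ j)\<^sup>2 \<le> B\<^sup>2 * (norm (e k \<omega>))\<^sup>2"
          by (intro mult_mono) auto
        from mult_left_mono[OF this, of "(\<gamma> k)\<^sup>2"]
        have "(\<gamma> k * w k \<omega> * e k \<omega> $ j)\<^sup>2 \<le> B\<^sup>2 * (\<gamma> k)\<^sup>2 * (norm (e k \<omega>))\<^sup>2"
          by (simp add: power_mult_distrib mult_ac)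
        then show ?case by (simp flip: ennreal_mult add: ennreal_leI)
      qed
    qed measurable
    moreover have "AE \<omega> in M. ?c * nn_cond_exp M (G k) ?q \<omega> = nn_cond_exp M (G k) (\<lambda>\<omega>. ?c * ?q \<omega>) \<omega>"
      by (rule S.nn_cond_exp_prod) measurable
    ultimately show "AE \<omega> in M. nn_cond_exp M (G k) (\<lambda>\<omega>. ennreal ((\<gamma> k * w k \<omega> * e k \<omega> $ j)\<^sup>2)) \<omega>
      \<le> ennreal (B\<^sup>2) * (ennreal ((\<gamma> k)\<^sup>2) * nn_cond_exp M (G k) ?q \<omega>)"
      by eventually_elim (simp add: ennreal_mult mult.assoc)
  qed
  with var show "AE \<omega> in M. (\<Sum>k. nn_cond_exp M (G k) (\<lambda>\<omega>. ennreal ((\<gamma> k * w k \<omega> * e k \<omega> $ j)\<^sup>2)) \<omega>) < \<infinity>"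
  proof eventually_elim
    case (elim \<omega>)
    have "(\<Sum>k. nn_cond_exp M (G k) (\<lambda>\<omega>. ennreal ((\<gamma> k * w k \<omega> * e k \<omega> $ j)\<^sup>2)) \<omega>)
        \<le> (\<Sum>k. ennreal (B\<^sup>2) * (ennreal ((\<gamma> k)\<^sup>2) * nn_cond_exp M (G k) (\<lambda>\<omega>. ennreal ((norm (e k \<omega>))\<^sup>2)) \<omega>))"
      using elim(2) by (intro suminf_le) auto
    also have "\<dots> < \<infinity>" using elim(1) by (simp add: ennreal_mult_less_top)
    finally show ?case .
  qed
qed

lemma squared_errors_summable:
  fixes e :: "nat \<Rightarrow> 'a \<Rightarrow> 'b::euclidean_space" and \<gamma> :: "nat \<Rightarrow> real"
  assumes e: "\<And>k. e k \<in> borel_measurable M"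
    and var: "AE \<omega> in M. (\<Sum>k. ennreal ((\<gamma> k)\<^sup>2) *
        nn_cond_exp M (G k) (\<lambda>\<omega>. ennreal ((norm (e k \<omega>))\<^sup>2)) \<omega>) < \<infinity>"
  shows "AE \<omega> in M. summable (\<lambda>k. (\<gamma> k)\<^sup>2 * (norm (e k \<omega>))\<^sup>2)"
proof -
  note [measurable] = e
  have "AE \<omega> in M. \<forall>k. ennreal ((\<gamma> k)\<^sup>2) * nn_cond_exp M (G k) (\<lambda>\<omega>. ennreal ((norm (e k \<omega>))\<^sup>2)) \<omega>
      = nn_cond_exp M (G k) (\<lambda>\<omega>. ennreal ((\<gamma> k)\<^sup>2) * ennreal ((norm (e k \<omega>))\<^sup>2)) \<omega>"
    unfolding AE_all_countable
  proof
    fix k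
    interpret S: sigma_finite_subalgebra M "G k" by (rule sub_sigma_finite)
    show "AE \<omega> in M. ennreal ((\<gamma> k)\<^sup>2) * nn_cond_exp M (G k) (\<lambda>\<omega>. ennreal ((norm (e k \<omega>))\<^sup>2)) \<omega>
      = nn_cond_exp M (G k) (\<lambda>\<omega>. ennreal ((\<gamma> k)\<^sup>2) * ennreal ((norm (e k \<omega>))\<^sup>2)) \<omega>"
      by (rule S.nn_cond_exp_prod) measurable
  qed
  with var have "AE \<omega> in M. (\<Sum>k. nn_cond_exp M (G k)
      (\<lambda>\<omega>. ennreal ((\<gamma> k)\<^sup>2) * ennreal ((norm (e k \<omega>))\<^sup>2)) \<omega>) < \<infinity>"
    by eventually_elim simp
  then have "AE \<omega> in M. (\<Sum>k. ennreal ((\<gamma> k)\<^sup>2) * ennreal ((norm (e k \<omega>))\<^sup>2)) < \<infinity>"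
    using suminf_finite_if_conditional_sum_finite
      [of "\<lambda>k \<omega>. ennreal ((\<gamma> k)\<^sup>2) * ennreal ((norm (e k \<omega>))\<^sup>2)"] by simp
  then show ?thesis
  proof eventually_elim
    case (elim \<omega>)
    then have "(\<Sum>k. ennreal ((\<gamma> k)\<^sup>2 * (norm (e k \<omega>))\<^sup>2)) \<noteq> top" by (simp add: ennreal_mult)
    then show ?case by (rule summable_suminf_not_top[rotated]) simp
  qed
qed

end

section \<open>Almost sure convergence to an equilibrium\<close>

theorem theorem2:
  fixes own :: "'n::finite \<Rightarrow> 'i::finite"
    and P :: "'p measure" and \<xi> :: "'p \<Rightarrow> real ^ 'd"
    and f :: "'i \<Rightarrow> real ^ 'n \<Rightarrow> real ^ 'd \<Rightarrow> real"
    and g :: "'i \<Rightarrow> real ^ 'n \<Rightarrow> ereal"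
    and \<Omega> :: "'i \<Rightarrow> (real ^ 'n) set"
    and F :: "real ^ 'n \<Rightarrow> real ^ 'n"
    and M :: "'w measure"
    and x :: "nat \<Rightarrow> 'w \<Rightarrow> real ^ 'n"
    and \<zeta> :: "nat \<Rightarrow> 'w \<Rightarrow> (real ^ 'd) ^ 'i"
    and \<epsilon> :: "nat \<Rightarrow> 'w \<Rightarrow> real ^ 'n"
    and \<gamma> :: "nat \<Rightarrow> real" and \<beta> :: real
  assumes prob_P: "prob_space P"
    and \<xi>_measurable: "\<xi> \<in> borel_measurable P"
    and f_measurable: "\<And>i. (\<lambda>(y, s). f i y s) \<in> borel_measurable (borel \<Otimes>\<^sub>M borel)"
    and f_integrable: "\<And>i y. integrable P (\<lambda>\<omega>. f i y (\<xi> \<omega>))"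
    and g_proper: "\<And>i u. u \<in> block_space own i \<Longrightarrow> g i u \<noteq> -\<infinity>"
    and g_lsc: "\<And>i. lsc_on (block_space own i) (g i)"
    and g_convex: "\<And>i. ereal_convex_on (block_space own i) (g i)"
    and g_dom: "\<And>i. {u \<in> block_space own i. g i u < \<infinity>} = \<Omega> i"
    and \<Omega>_nonempty: "\<And>i. \<Omega> i \<noteq> {}"
    and \<Omega>_compact: "\<And>i. compact (\<Omega> i)"
    and \<Omega>_convex: "\<And>i. convex (\<Omega> i)"
    and Ef_convex: "\<And>i y. convex_on UNIV (\<lambda>u. \<integral>\<omega>. f i (with_block own i u y) (\<xi> \<omega>) \<partial>P)"
    and Ef_diff: "\<And>i y. cont_diff (\<lambda>u. \<integral>\<omega>. f i (with_block own i u y) (\<xi> \<omega>) \<partial>P)"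
    and f_convex: "\<And>i y s. convex_on UNIV (\<lambda>u. f i (with_block own i u y) s)"
    and f_diff: "\<And>i y s. cont_diff (\<lambda>u. f i (with_block own i u y) s)"
    and f_sample_measurable: "\<And>i y. f i y \<in> borel_measurable borel"
    and f_lipschitz: "\<And>i y. \<exists>l. integrable P (\<lambda>\<omega>. l (\<xi> \<omega>)) \<and>
          (\<forall>s. (l s)-lipschitz_on UNIV (\<lambda>u. f i (with_block own i u y) s))"
    and F_eq: "\<And>y. F y = pseudogradient own P \<xi> f y"
    and F_lipschitz: "\<exists>L. L-lipschitz_on UNIV F"
    and \<beta>_pos: "\<beta> > 0"
    and F_cocoercive: "\<And>y z. z \<in> SOL own \<Omega> F g \<Longrightarrow>
          (F y - F z) \<bullet> (y - z) \<ge> \<beta> * (norm (F y - F z))\<^sup>2"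
    and prob_M: "prob_space M"
    and x0_measurable: "x 0 \<in> borel_measurable M"
    and \<zeta>_indep: "prob_space.indep_vars M (\<lambda>_. borel) \<zeta> UNIV"
    and \<zeta>_ident: "\<And>k. distr M borel (\<zeta> k) = distr M borel (\<zeta> 0)"
    and \<zeta>_distr: "\<And>k i. distr M borel (\<lambda>\<omega>. \<zeta> k \<omega> $ i) = distr P borel \<xi>"
    and \<zeta>_indep_x0: "prob_space.indep_set M
          (sets (vimage_algebra (space M) (x 0) borel))
          (sets (vimage_algebra (space M) (\<lambda>\<omega> k. \<zeta> k \<omega>) (\<Pi>\<^sub>M k\<in>UNIV. borel)))"
    and \<epsilon>_eq: "\<And>k \<omega>. \<epsilon> k \<omega> = sampled_pseudogradient own f (x k \<omega>) (\<zeta> k \<omega>) - F (x k \<omega>)"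
    and \<epsilon>_unbiased: "\<And>k j. AE \<omega> in M.
          real_cond_exp M (history M (x 0) \<zeta> k) (\<lambda>\<omega>. \<epsilon> k \<omega> $ j) \<omega> = 0"
    and \<gamma>_pos: "\<And>k. \<gamma> k > 0"
    and \<gamma>_le: "\<And>k. \<gamma> k \<le> 2 * \<beta>"
    and \<gamma>_sum: "(\<Sum>k. ennreal (\<gamma> k)) = \<infinity>"
    and \<gamma>_sum_sq: "(\<Sum>k. ennreal ((\<gamma> k)\<^sup>2)) < \<infinity>"
    and \<gamma>_sum_var: "AE \<omega> in M. (\<Sum>k. ennreal ((\<gamma> k)\<^sup>2) *
          nn_cond_exp M (history M (x 0) \<zeta> k) (\<lambda>\<omega>. ennreal ((norm (\<epsilon> k \<omega>))\<^sup>2)) \<omega>) < \<infinity>"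
    and x_init: "\<And>\<omega> i. \<omega> \<in> space M \<Longrightarrow> block own i (x 0 \<omega>) \<in> \<Omega> i"
    and x_step: "\<And>k \<omega> i. \<omega> \<in> space M \<Longrightarrow>
          block own i (x (Suc k) \<omega>) =
            prox (block_space own i) (\<lambda>u. ereal (\<gamma> k) * g i u)
              (block own i (x k \<omega>)
                - \<gamma> k *\<^sub>R partial_grad own i (\<lambda>y. f i y (\<zeta> k \<omega> $ i)) (x k \<omega>))"
  shows "AE \<omega> in M. \<exists>z \<in> SOL own \<Omega> F g. (\<lambda>k. x k \<omega>) \<longlonglongrightarrow> z"
proof -
  interpret M: prob_space M by (rule prob_M)
  let ?H = "history M (x 0) \<zeta>"
  have \<zeta>_measurable: "\<zeta> j \<in> borel_measurable M" for j
    using \<zeta>_indep by (simp add: M.indep_vars_def2)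
  interpret filtered_prob_space M ?H
    by unfold_locales (intro subalgebra_history subalgebra_history_Suc x0_measurable \<zeta>_measurable)+
  interpret block_regularised_game own g \<Omega>
    by unfold_locales (fact g_proper g_lsc g_convex g_dom \<Omega>_nonempty \<Omega>_compact \<Omega>_convex)+
  have F_cont: "continuous_on S F" for S
    using F_lipschitz lipschitz_on_continuous_on continuous_on_subset by blast
  \<comment> \<open>The sampled direction is \<open>F\<close> plus the error, and the agents' steps form one joint step.\<close>
  have step: "prox_point K (\<lambda>u. \<gamma> k * \<Phi> u) (x k \<omega> - \<gamma> k *\<^sub>R (F (x k \<omega>) + \<epsilon> k \<omega>)) (x (Suc k) \<omega>)"
    if "\<omega> \<in> space M" for k \<omega>
  proof -
    have "prox_point K (\<lambda>u. \<gamma> k * \<Phi> u)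
        (x k \<omega> - \<gamma> k *\<^sub>R col own (\<lambda>i. partial_grad own i (\<lambda>y. f i y (\<zeta> k \<omega> $ i)) (x k \<omega>))) (x (Suc k) \<omega>)"
      by (rule joint_prox_point) (simp add: x_step[OF that] block_prox_point \<gamma>_pos)
    then show ?thesis by (simp add: \<epsilon>_eq sampled_pseudogradient_def)
  qed
  have x_K: "x k \<omega> \<in> K" if "\<omega> \<in> space M" for k \<omega>
    using x_init[OF that] step[OF that] by (cases k) (auto simp: joint_set_def prox_point_def)
  have sampled: "(\<lambda>\<omega>. sampled_pseudogradient own f (x k \<omega>) (\<zeta> k \<omega>)) \<in> borel_measurable (?H (Suc k))"
    if "x k \<in> borel_measurable (?H k)" for k
    by (rule sampled_pseudogradient_measurable[OF f_measurable f_diff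
          measurable_G_mono[OF that] sample_measurable_history]) auto
  \<comment> \<open>A proximal step adds only the sample of its own time to the information used.\<close>
  have x_meas: "x k \<in> borel_measurable (?H k)" for k
  proof (induction k)
    case 0
    show ?case by (rule initial_measurable_history)
  next
    case (Suc k)
    have x: "x k \<in> borel_measurable (?H (Suc k))" using Suc by (rule measurable_G_mono) simp
    have "(\<lambda>\<omega>. block own i (x (Suc k) \<omega>)) \<in> borel_measurable (?H (Suc k))" for i
    proof -
      have "(\<lambda>\<omega>. block own i (x k \<omega>)) \<in> borel_measurable (?H (Suc k))"
        using measurable_compose[OF x borel_measurable_continuous_onI[OF continuous_on_block]] .
      moreover have "(\<lambda>\<omega>. partial_grad own i (\<lambda>y. f i y (\<zeta> k \<omega> $ i)) (x k \<omega>)) \<in> borel_measurable (?H (Suc k))"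
        by (rule partial_grad_measurable[OF f_measurable f_diff x
              borel_measurable_nth[OF sample_measurable_history]]) simp
      ultimately have "(\<lambda>\<omega>. block own i (x k \<omega>)
          - \<gamma> k *\<^sub>R partial_grad own i (\<lambda>y. f i y (\<zeta> k \<omega> $ i)) (x k \<omega>)) \<in> borel_measurable (?H (Suc k))"
        by measurable
      from measurable_compose[OF this borel_measurable_continuous_onI[OF continuous_on_prox[OF \<gamma>_pos]]]
      show ?thesis by (subst measurable_cong) (auto simp: x_step)
    qed
    then have "(\<lambda>\<omega>. \<Sum>i\<in>UNIV. block own i (x (Suc k) \<omega>)) \<in> borel_measurable (?H (Suc k))"
      by (intro borel_measurable_sum)
    then show ?case by (simp add: sum_blocks)
  qed
  have \<epsilon>_meas: "\<epsilon> k \<in> borel_measurable (?H (Suc k))" for k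
  proof -
    have "(\<lambda>\<omega>. F (x k \<omega>)) \<in> borel_measurable (?H (Suc k))"
      using measurable_compose[OF measurable_G_mono[OF x_meas] borel_measurable_continuous_onI[OF F_cont]]
      by simp
    then show ?thesis using sampled[OF x_meas] unfolding \<epsilon>_eq[abs_def] by measurable
  qed
  obtain B where B: "norm u \<le> B" if "u \<in> K" for u
    using compact_imp_bounded[OF K_compact] unfolding bounded_iff by blast
  have sq: "AE \<omega> in M. summable (\<lambda>k. (\<gamma> k)\<^sup>2 * (norm (\<epsilon> k \<omega>))\<^sup>2)"
    by (rule squared_errors_summable[OF measurable_G_imp_M[OF \<epsilon>_meas] \<gamma>_sum_var])
  \<comment> \<open>The weight \<open>1\<close> is written out to match the general weighted series.\<close>
  have err: "AE \<omega> in M. \<forall>j. summable (\<lambda>k. \<gamma> k * 1 * \<epsilon> k \<omega> $ j)"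
    unfolding AE_all_countable
    by (intro allI weighted_errors_summable[OF \<epsilon>_meas \<epsilon>_unbiased \<gamma>_sum_var, where B = 1]) auto
  have err_x: "AE \<omega> in M. \<forall>j. summable (\<lambda>k. \<gamma> k * x k \<omega> $ j * \<epsilon> k \<omega> $ j)"
    unfolding AE_all_countable
  proof
    fix j
    have "\<bar>x k \<omega> $ j\<bar> \<le> B" if "\<omega> \<in> space M" for k \<omega>
      using component_le_norm_cart[of "x k \<omega>" j] B[OF x_K[OF that]] by (rule order_trans)
    then show "AE \<omega> in M. summable (\<lambda>k. \<gamma> k * x k \<omega> $ j * \<epsilon> k \<omega> $ j)"
      by (rule weighted_errors_summable[OF \<epsilon>_meas \<epsilon>_unbiased \<gamma>_sum_var borel_measurable_nth[OF x_meas]])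
  qed
  have \<gamma>_div: "\<not> summable \<gamma>"
    using \<gamma>_sum ennreal_suminf_neq_top[of \<gamma>] \<gamma>_pos by (auto simp: less_imp_le)
  have \<gamma>_sq: "summable (\<lambda>k. (\<gamma> k)\<^sup>2)"
    using \<gamma>_sum_sq by (intro summable_suminf_not_top) auto
  show ?thesis
    using sq err err_x AE_space
  proof eventually_elim
    case (elim \<omega>)
    have "\<gamma> k *\<^sub>R \<epsilon> k \<omega> = (\<Sum>j\<in>UNIV. (\<gamma> k * 1 * \<epsilon> k \<omega> $ j) *\<^sub>R axis j 1)" for k
      by (simp add: vec_eq_iff axis_def if_distrib cong: if_cong)
    moreover have "summable (\<lambda>k. \<Sum>j\<in>UNIV. (\<gamma> k * 1 * \<epsilon> k \<omega> $ j) *\<^sub>R (axis j 1 :: real ^ 'n))"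
      using elim(2) by (intro summable_sum summable_scaleR_left) auto
    ultimately have s1: "summable (\<lambda>k. \<gamma> k *\<^sub>R \<epsilon> k \<omega>)" by simp
    have "\<gamma> k * (\<epsilon> k \<omega> \<bullet> x k \<omega>) = (\<Sum>j\<in>UNIV. \<gamma> k * x k \<omega> $ j * \<epsilon> k \<omega> $ j)" for k
      by (simp add: inner_vec_def sum_distrib_left mult_ac)
    moreover have "summable (\<lambda>k. \<Sum>j\<in>UNIV. \<gamma> k * x k \<omega> $ j * \<epsilon> k \<omega> $ j)"
      using elim(3) by (intro summable_sum) auto
    ultimately have s2: "summable (\<lambda>k. \<gamma> k * (\<epsilon> k \<omega> \<bullet> x k \<omega>))" by simp
    have coco: "\<beta> * (norm (F y - F z))\<^sup>2 \<le> (F y - F z) \<bullet> (y - z)" if "z \<in> vi_solutions K \<Phi> F" for y z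
      using F_cocoercive that by (simp add: SOL_eq)
    show ?case unfolding SOL_eq
      by (rule forward_backward_converges[OF K_compact K_convex K_nonempty \<Phi>_convex \<Phi>_lsc F_cont
            \<beta>_pos coco \<gamma>_pos \<gamma>_div \<gamma>_sq x_K[OF elim(4)] step[OF elim(4)] elim(1) s2 s1])
  qed
qed

end
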